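(* Let $-2<a<2$, let $C$ be a closed invariant curve around the origin of the McMillan sextupole map on the level $\mathcal{K}_{\mathrm{sxt}}=\mathrm{H}$, and let $q_1<q_2<q_3<q_4$ be the roots of $$\mathcal{P}(q)=q^4-2(2+a)q^3+(a^2-4)q^2+4\mathrm{H}q+4\mathrm{H}.$$ Put $\kappa=\sqrt{\frac{(q_3-q_2)(q_4-q_1)}{(q_3-q_1)(q_4-q_2)}}$ and $$\mathrm{T}'=\int_{q_2}^{q_2'}\frac{dq}{\sqrt{\mathcal{P}(q)}},\qquad q_2'=\frac{f(q_2)}{2}=-\frac{q_2(q_2-a)}{2(q_2+1)}.$$ Let $(x_n,y_n)_{n\ge 0}$ be the orbit, with coordinates $(q,p)=(x_n,y_n)$, of a point $(x_0,y_0)\in C$. Taking the integral of $dt=\pm\,dq/\sqrt{\mathcal{P}(q)}$ from $q(0)=x_0$ to $q(t)$ gives the parametrization of the map $$x_n=q(n\mathrm{T}'),\qquad y_{n-1}=q(n\mathrm{T}'),$$ where $$q(t)=\frac{q_2-q_1\frac{q_3-q_2}{q_3-q_1}\,\mathrm{sn}_1^2}{1-\frac{q_3-q_2}{q_3-q_1}\,\mathrm{sn}_1^2}=\frac{q_3-q_4\frac{q_3-q_2}{q_4-q_2}\,\mathrm{sn}_2^2}{1-\frac{q_3-q_2}{q_4-q_2}\,\mathrm{sn}_2^2},\qquad \mathrm{sn}_i=\mathrm{sn}\left[\sqrt{(q_4-q_2)(q_3-q_1)}\,\frac{t-t_i^*}{2},\kappa\right],$$ with initial phase shifts $$t_1^*=-\frac{2\,\mathrm{F}\left[\arcsin\sqrt{\frac{(q_3-q_1)(x_0-q_2)}{(q_3-q_2)(x_0-q_1)}},\kappa\right]}{\sqrt{(q_4-q_2)(q_3-q_1)}},\qquad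 t_2^*=+\frac{2\,\mathrm{F}\left[\arcsin\sqrt{\frac{(q_4-q_2)(x_0-q_3)}{(q_3-q_2)(x_0-q_4)}},\kappa\right]}{\sqrt{(q_4-q_2)(q_3-q_1)}}.$$
   Context: The McMillan sextupole map with parameter $a$ is $q'=p$, $p'=-q+f(p)$ with $f(p)=-p\,\dfrac{p-a}{p+1}$. It preserves $\mathcal{K}_{\mathrm{sxt}}[p,q]=p^2q+pq^2+p^2-a\,pq+q^2$, and the origin is a fixed point. A closed invariant curve around the origin is a connected component of a level set $\{\mathcal{K}_{\mathrm{sxt}}=\mathrm{H}\}$ that is a simple closed curve encircling the origin; for $|a|<2$ such curves have $\mathrm{H}>0$, the polynomial $\mathcal{P}$ has four distinct real roots, and $q_2\le q\le q_3$ on the curve. On the level set, $p=\frac12\left[f(q)\pm\frac{\sqrt{\mathcal{P}(q)}}{q+1}\right]$; taking $\mathcal{K}_{\mathrm{sxt}}$ as a Hamiltonian with time $t$, the first Hamilton equation $dq/dt=\partial\mathcal{K}_{\mathrm{sxt}}/\partial p$ becomes $dt=\pm\,dq/\sqrt{\mathcal{P}(q)}$, and $\mathrm{T}'$ is the time of one step of the map along this flow. $\mathrm{sn}[u,\kappa]$ is the Jacobi elliptic sine with modulus $\kappa$ and $\mathrm{F}[\phi,\kappa]=\int_0^{\phi}\frac{d\theta}{\sqrt{1-\kappa^2\sin^2\theta}}$.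
   Formalization: The printed signs of both phase shifts hold only for initial points with y_0 ≥ f(x_0)/2; for initial points on the lower branch, where they would give the backward orbit, both phase shifts have the opposite sign. *)

theory Defs
  imports "HOL-Analysis.Analysis"
begin

definition sxt_f :: "real \<Rightarrow> real \<Rightarrow> real" where
  "sxt_f a p = - p * ((p - a) / (p + 1))"

(* Points of the phase plane are pairs (q, p). *)
definition sxt_map :: "real \<Rightarrow> real \<times> real \<Rightarrow> real \<times> real" where
  "sxt_map a = (\<lambda>(q, p). (p, - q + sxt_f a p))"

definition K_sxt :: "real \<Rightarrow> real \<Rightarrow> real \<Rightarrow> real" where
  "K_sxt a p q = p\<^sup>2 * q + p * q\<^sup>2 + p\<^sup>2 - a * p * q + q\<^sup>2"

definition closed_invariant_curve :: "real \<Rightarrow> real \<Rightarrow> (real \<times> real) set \<Rightarrow> bool" where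
  "closed_invariant_curve a H C \<longleftrightarrow>
     C \<in> components {(q, p). K_sxt a p q = H} \<and>
     (\<exists>g. simple_path g \<and> pathfinish g = pathstart g \<and> path_image g = C) \<and>
     (0, 0) \<in> inside C"

(* The discriminant of K_sxt a p q = H, regarded as a quadratic equation in p. *)
definition sxt_P :: "real \<Rightarrow> real \<Rightarrow> real \<Rightarrow> real" where
  "sxt_P a H q = q^4 - 2 * (2 + a) * q^3 + (a\<^sup>2 - 4) * q\<^sup>2 + 4 * H * q + 4 * H"

(* On the level set, p = (f(q) + s * sqrt (P(q)) / (q + 1)) / 2 with s = 1 or s = -1, and
   dK/dp = 2 * (q + 1) * (p - f(q) / 2) = s * sqrt (P(q)), so that the Hamilton equation reads
   dt = s * dq / sqrt (P(q)).  Closed invariant curves around the origin lie in q > -1, so s is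
   the side of p = f(q) / 2 on which (q, p) lies; if p = f(q) / 2, then both signs are valid. *)
definition branch_sign :: "real \<Rightarrow> real \<Rightarrow> real \<Rightarrow> real" where
  "branch_sign a q p = (if sxt_f a q / 2 \<le> p then 1 else - 1)"

(* The integral is oriented, so this is an odd function of \<phi>. *)
definition elliptic_F :: "real \<Rightarrow> real \<Rightarrow> real" where
  "elliptic_F \<phi> \<kappa> = (LBINT \<theta>=0..\<phi>. 1 / sqrt (1 - \<kappa>\<^sup>2 * (sin \<theta>)\<^sup>2))"

(* The amplitude.  For \<kappa>\<^sup>2 < 1 the map \<phi> \<mapsto> elliptic_F \<phi> \<kappa> is a strictly increasing bijection of
   the real line, so the description is proper. *)
definition jacobi_am :: "real \<Rightarrow> real \<Rightarrow> real" where
  "jacobi_am u \<kappa> = (THE \<phi>. elliptic_F \<phi> \<kappa> = u)"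

definition jacobi_sn :: "real \<Rightarrow> real \<Rightarrow> real" where
  "jacobi_sn u \<kappa> = sin (jacobi_am u \<kappa>)"

end

theory Submission
  imports Defs
begin

text \<open>
  On the level set, \<open>w = dq/dt\<close> satisfies \<open>w\<^sup>2 = P(q)\<close> and hence \<open>q'' = P'(q) / 2\<close>, and so does the momentum
  \<open>p\<close> along the flow.  The Moebius image of \<open>sn\<^sup>2\<close> sending \<open>0, 1, 1/\<kappa>\<^sup>2, \<infinity>\<close> to \<open>q2, q3, q4, q1\<close> solves
  the same equation, as does the one with the roots in reverse order.  Uniqueness for this equation therefore
  yields both closed forms of \<open>q(t)\<close>, and also the relation \<open>p(t) = q(t + T')\<close>, which says that one
  step of the map is the flow for time \<open>T'\<close>.

  Geometrically, a simple closed curve cannot cross the line \<open>q = -1\<close>, which the level set meets in at most one point or contains;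
  since it extends to both sides along a branch wherever \<open>P > 0\<close>, its extreme values of \<open>q\<close> are roots of
  \<open>P\<close>, namely \<open>q2\<close> and \<open>q3\<close>.
\<close>

section \<open>Jacobi elliptic functions\<close>

lemma one_minus_k_sin_pos:
  fixes k \<phi> :: real
  assumes "k\<^sup>2 < 1"
  shows "0 < 1 - k\<^sup>2 * (sin \<phi>)\<^sup>2"
proof -
  have "k\<^sup>2 * (sin \<phi>)\<^sup>2 \<le> k\<^sup>2 * 1"
    by (intro mult_left_mono) (auto simp: abs_square_le_1)
  then show ?thesis using assms by linarith
qed

lemma elliptic_F_0 [simp]: "elliptic_F 0 k = 0"
  by (simp add: elliptic_F_def zero_ereal_def)

lemma has_real_derivative_elliptic_F:
  assumes "k\<^sup>2 < 1"
  shows "((\<lambda>\<phi>. elliptic_F \<phi> k) has_real_derivative 1 / sqrt (1 - k\<^sup>2 * (sin \<phi>)\<^sup>2)) (at \<phi>)"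
proof -
  define M where "M = \<bar>\<phi>\<bar> + 1"
  have cont: "continuous_on {-M..M} (\<lambda>\<theta>. 1 / sqrt (1 - k\<^sup>2 * (sin \<theta>)\<^sup>2))"
    using one_minus_k_sin_pos[OF assms] by (intro continuous_intros) (auto simp: less_imp_neq[symmetric])
  have "((\<lambda>u. LBINT \<theta>=0..u. 1 / sqrt (1 - k\<^sup>2 * (sin \<theta>)\<^sup>2)) has_vector_derivative
      1 / sqrt (1 - k\<^sup>2 * (sin \<phi>)\<^sup>2)) (at \<phi> within {-M..M})"
    using interval_integral_FTC2[of "-M" 0 M, OF _ _ cont, of \<phi>]
    by (auto simp: M_def zero_ereal_def)
  moreover have "at \<phi> within {-M..M} = at \<phi>"
    by (intro at_within_interior) (auto simp: M_def)
  ultimately show ?thesis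
    by (simp add: elliptic_F_def has_real_derivative_iff_has_vector_derivative)
qed

text \<open>The integrand is at least 1, so F grows at least as fast as the identity. This gives
  strict monotonicity and unboundedness at once, hence the bijectivity behind
  \<open>jacobi_am\<close>.\<close>

lemma elliptic_F_expands:
  assumes "k\<^sup>2 < 1" "\<phi> \<le> \<psi>"
  shows "\<psi> - \<phi> \<le> elliptic_F \<psi> k - elliptic_F \<phi> k"
proof -
  have "\<exists>d\<ge>0. ((\<lambda>\<phi>. elliptic_F \<phi> k - \<phi>) has_real_derivative d) (at \<theta>)" for \<theta>
  proof -
    have "0 < sqrt (1 - k\<^sup>2 * (sin \<theta>)\<^sup>2)" "sqrt (1 - k\<^sup>2 * (sin \<theta>)\<^sup>2) \<le> 1"
      using one_minus_k_sin_pos[OF assms(1)] by auto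
    then have "0 \<le> 1 / sqrt (1 - k\<^sup>2 * (sin \<theta>)\<^sup>2) - 1" by simp
    then show ?thesis
      using has_real_derivative_elliptic_F[OF assms(1), of \<theta>]
      by (intro exI[of _ "1 / sqrt (1 - k\<^sup>2 * (sin \<theta>)\<^sup>2) - 1"] conjI derivative_intros) auto
  qed
  then have "elliptic_F \<phi> k - \<phi> \<le> elliptic_F \<psi> k - \<psi>"
    using DERIV_nonneg_imp_nondecreasing[OF assms(2), of "\<lambda>\<phi>. elliptic_F \<phi> k - \<phi>"] by blast
  then show ?thesis by simp
qed

lemma elliptic_F_less_iff:
  assumes "k\<^sup>2 < 1"
  shows "elliptic_F \<phi> k < elliptic_F \<psi> k \<longleftrightarrow> \<phi> < \<psi>"
  using elliptic_F_expands[OF assms, of \<phi> \<psi>] elliptic_F_expands[OF assms, of \<psi> \<phi>] by linarith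

lemma elliptic_F_le_iff:
  assumes "k\<^sup>2 < 1"
  shows "elliptic_F \<phi> k \<le> elliptic_F \<psi> k \<longleftrightarrow> \<phi> \<le> \<psi>"
  using elliptic_F_less_iff[OF assms, of \<psi> \<phi>] by linarith

lemma elliptic_F_minus:
  assumes "k\<^sup>2 < 1"
  shows "elliptic_F (- \<phi>) k = - elliptic_F \<phi> k"
proof -
  have "((\<lambda>\<phi>. elliptic_F (- \<phi>) k + elliptic_F \<phi> k) has_real_derivative 0) (at \<theta>)" for \<theta>
  proof -
    have "((\<lambda>\<phi>. elliptic_F (- \<phi>) k + elliptic_F \<phi> k) has_real_derivative
        1 / sqrt (1 - k\<^sup>2 * (sin (- \<theta>))\<^sup>2) * (- 1) + 1 / sqrt (1 - k\<^sup>2 * (sin \<theta>)\<^sup>2)) (at \<theta>)"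
      by (intro DERIV_add DERIV_chain2[OF has_real_derivative_elliptic_F[OF assms]]
          has_real_derivative_elliptic_F[OF assms] derivative_eq_intros) auto
    then show ?thesis by simp
  qed
  then have "elliptic_F (- \<phi>) k + elliptic_F \<phi> k = elliptic_F (- 0) k + elliptic_F 0 k"
    using DERIV_isconst_all[of "\<lambda>\<phi>. elliptic_F (- \<phi>) k + elliptic_F \<phi> k" \<phi> 0] by blast
  then show ?thesis by simp
qed

lemma isCont_elliptic_F:
  assumes "k\<^sup>2 < 1"
  shows "isCont (\<lambda>\<phi>. elliptic_F \<phi> k) \<phi>"
  using has_real_derivative_elliptic_F[OF assms] by (rule DERIV_isCont)

lemma continuous_on_elliptic_F:
  assumes "k\<^sup>2 < 1"
  shows "continuous_on S (\<lambda>\<phi>. elliptic_F \<phi> k)"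
  using isCont_elliptic_F[OF assms] by (simp add: continuous_at_imp_continuous_on)

lemma jacobi_am_elliptic_F:
  assumes "k\<^sup>2 < 1"
  shows "jacobi_am (elliptic_F \<phi> k) k = \<phi>"
  unfolding jacobi_am_def
proof (rule the_equality)
  show "\<psi> = \<phi>" if "elliptic_F \<psi> k = elliptic_F \<phi> k" for \<psi>
    using elliptic_F_le_iff[OF assms, of \<psi> \<phi>] elliptic_F_le_iff[OF assms, of \<phi> \<psi>] that by simp
qed simp

lemma elliptic_F_jacobi_am:
  assumes "k\<^sup>2 < 1"
  shows "elliptic_F (jacobi_am u k) k = u"
proof -
  \<comment> \<open>Since F vanishes at 0 and expands distances, its values at the points -|u| and
    |u| enclose u, as the intermediate value theorem requires.\<close>
  have "elliptic_F (- \<bar>u\<bar>) k \<le> u" "u \<le> elliptic_F \<bar>u\<bar> k"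
    using elliptic_F_expands[OF assms, of "- \<bar>u\<bar>" 0] elliptic_F_expands[OF assms, of 0 "\<bar>u\<bar>"] by auto
  then obtain \<phi> where "elliptic_F \<phi> k = u"
    using IVT'[of "\<lambda>\<phi>. elliptic_F \<phi> k" "- \<bar>u\<bar>" u "\<bar>u\<bar>"] continuous_on_elliptic_F[OF assms] by auto
  then show ?thesis using jacobi_am_elliptic_F[OF assms] by metis
qed

text \<open>The amplitude inverts F, so its derivative is the reciprocal of the integrand at the
  amplitude.\<close>

lemma has_real_derivative_jacobi_am:
  assumes "k\<^sup>2 < 1"
  shows "((\<lambda>u. jacobi_am u k) has_real_derivative sqrt (1 - k\<^sup>2 * (jacobi_sn u k)\<^sup>2)) (at u)"
proof -
  have "isCont (\<lambda>u. jacobi_am u k) (elliptic_F (jacobi_am u k) k)"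
    by (rule isCont_inverse_function[where d = 1 and f = "\<lambda>\<phi>. elliptic_F \<phi> k"])
      (simp_all add: jacobi_am_elliptic_F isCont_elliptic_F assms)
  then have "((\<lambda>u. jacobi_am u k) has_real_derivative
      inverse (1 / sqrt (1 - k\<^sup>2 * (sin (jacobi_am u k))\<^sup>2))) (at u)"
    using one_minus_k_sin_pos[OF assms, of "jacobi_am u k"]
    by (intro DERIV_inverse_function[where f = "\<lambda>\<phi>. elliptic_F \<phi> k" and a = "u - 1" and b = "u + 1",
          OF has_real_derivative_elliptic_F[OF assms]])
      (simp_all add: elliptic_F_jacobi_am assms)
  then show ?thesis by (simp add: jacobi_sn_def)
qed

lemma jacobi_am_minus:
  assumes "k\<^sup>2 < 1"
  shows "jacobi_am (- u) k = - jacobi_am u k"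
  by (metis assms elliptic_F_jacobi_am elliptic_F_minus jacobi_am_elliptic_F)

lemma jacobi_am_le_iff:
  assumes "k\<^sup>2 < 1"
  shows "jacobi_am u k \<le> \<phi> \<longleftrightarrow> u \<le> elliptic_F \<phi> k"
  using elliptic_F_le_iff[OF assms, of "jacobi_am u k" \<phi>] elliptic_F_jacobi_am[OF assms] by simp

lemma jacobi_am_nonneg_iff:
  assumes "k\<^sup>2 < 1"
  shows "0 \<le> jacobi_am u k \<longleftrightarrow> 0 \<le> u"
  using elliptic_F_le_iff[OF assms, of 0 "jacobi_am u k"] elliptic_F_jacobi_am[OF assms] by simp

section \<open>The companion functions cn and dn\<close>

definition jacobi_cn :: "real \<Rightarrow> real \<Rightarrow> real" where
  "jacobi_cn u k = cos (jacobi_am u k)"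

definition jacobi_dn :: "real \<Rightarrow> real \<Rightarrow> real" where
  "jacobi_dn u k = sqrt (1 - k\<^sup>2 * (jacobi_sn u k)\<^sup>2)"

lemma jacobi_cn_squared: "(jacobi_cn u k)\<^sup>2 = 1 - (jacobi_sn u k)\<^sup>2"
  by (simp add: jacobi_cn_def jacobi_sn_def cos_squared_eq)

lemma jacobi_dn_pos: "k\<^sup>2 < 1 \<Longrightarrow> 0 < jacobi_dn u k"
  by (simp only: jacobi_dn_def jacobi_sn_def real_sqrt_gt_0_iff one_minus_k_sin_pos)

lemma jacobi_dn_squared: "k\<^sup>2 < 1 \<Longrightarrow> (jacobi_dn u k)\<^sup>2 = 1 - k\<^sup>2 * (jacobi_sn u k)\<^sup>2"
  using one_minus_k_sin_pos[of k "jacobi_am u k"] by (simp add: jacobi_dn_def jacobi_sn_def)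

lemma jacobi_sn_minus: "k\<^sup>2 < 1 \<Longrightarrow> jacobi_sn (- u) k = - jacobi_sn u k"
  by (simp add: jacobi_sn_def jacobi_am_minus)

lemma jacobi_cn_minus: "k\<^sup>2 < 1 \<Longrightarrow> jacobi_cn (- u) k = jacobi_cn u k"
  by (simp add: jacobi_cn_def jacobi_am_minus)

lemma jacobi_dn_minus: "k\<^sup>2 < 1 \<Longrightarrow> jacobi_dn (- u) k = jacobi_dn u k"
  by (simp add: jacobi_dn_def jacobi_sn_minus)

lemma has_real_derivative_jacobi_sn:
  assumes "k\<^sup>2 < 1"
  shows "((\<lambda>u. jacobi_sn u k) has_real_derivative jacobi_cn u k * jacobi_dn u k) (at u)"
  unfolding jacobi_sn_def[abs_def] jacobi_cn_def
  using has_real_derivative_jacobi_am[OF assms, of u]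
  by (auto intro!: derivative_eq_intros simp: jacobi_dn_def)

lemma has_real_derivative_jacobi_cn:
  assumes "k\<^sup>2 < 1"
  shows "((\<lambda>u. jacobi_cn u k) has_real_derivative - jacobi_sn u k * jacobi_dn u k) (at u)"
  unfolding jacobi_cn_def[abs_def] jacobi_sn_def
  using has_real_derivative_jacobi_am[OF assms, of u]
  by (auto intro!: derivative_eq_intros simp: jacobi_dn_def jacobi_sn_def)

lemma has_real_derivative_jacobi_dn:
  assumes "k\<^sup>2 < 1"
  shows "((\<lambda>u. jacobi_dn u k) has_real_derivative - k\<^sup>2 * jacobi_sn u k * jacobi_cn u k) (at u)"
proof -
  have pos: "0 < 1 - k\<^sup>2 * (jacobi_sn u k)\<^sup>2"
    unfolding jacobi_sn_def by (rule one_minus_k_sin_pos[OF assms])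
  show ?thesis
    unfolding jacobi_dn_def[abs_def]
    using has_real_derivative_jacobi_sn[OF assms, of u] pos jacobi_dn_pos[OF assms, of u]
    by (auto intro!: derivative_eq_intros simp: jacobi_dn_def field_simps)
qed

section \<open>The elliptic integral of a quartic with four real roots\<close>

locale quartic =
  fixes r1 r2 r3 r4 k :: real
  assumes monotone_roots: "r1 < r2 \<and> r2 < r3 \<and> r3 < r4 \<or> r4 < r3 \<and> r3 < r2 \<and> r2 < r1"
    and k: "k = sqrt (((r3 - r2) * (r4 - r1)) / ((r3 - r1) * (r4 - r2)))"
begin

definition P :: "real \<Rightarrow> real" where
  "P z = (z - r1) * (z - r2) * (z - r3) * (z - r4)"

definition \<alpha> :: real where "\<alpha> = (r3 - r2) / (r3 - r1)"

definition \<omega> :: real where "\<omega> = sqrt ((r4 - r2) * (r3 - r1))"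

definition Q :: "real \<Rightarrow> real" where
  "Q t = (r2 - r1 * \<alpha> * (jacobi_sn (\<omega> * (t / 2)) k)\<^sup>2) / (1 - \<alpha> * (jacobi_sn (\<omega> * (t / 2)) k)\<^sup>2)"

text \<open>This is dQ/dt in explicit form. Unlike the square root of \<open>P\<close>, it keeps the
  direction of motion.\<close>

definition Q' :: "real \<Rightarrow> real" where
  "Q' t = \<alpha> * (r2 - r1) * \<omega> * jacobi_sn (\<omega> * (t / 2)) k * jacobi_cn (\<omega> * (t / 2)) k * jacobi_dn (\<omega> * (t / 2)) k
    / (1 - \<alpha> * (jacobi_sn (\<omega> * (t / 2)) k)\<^sup>2)\<^sup>2"

text \<open>Inverse of the Moebius map: the value of sn squared at which \<open>Q\<close> equals
  \<open>z\<close>.\<close>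

definition A :: "real \<Rightarrow> real" where
  "A z = ((r3 - r1) * (z - r2)) / ((r3 - r2) * (z - r1))"

text \<open>For \<open>z\<close> between \<open>r2\<close> and \<open>r3\<close>, this is the time
  of the first passage of \<open>Q\<close> through \<open>z\<close> after starting at
  \<open>r2\<close>.\<close>

definition \<tau> :: "real \<Rightarrow> real" where
  "\<tau> z = 2 * elliptic_F (arcsin (sqrt (A z))) k / \<omega>"

lemma \<alpha>_bounds: "0 < \<alpha>" "\<alpha> < 1"
  using monotone_roots by (auto simp: \<alpha>_def field_simps)

lemma \<omega>_pos: "0 < \<omega>"
  using monotone_roots by (auto simp: \<omega>_def zero_less_mult_iff)

lemma \<omega>_squared: "\<omega>\<^sup>2 = (r4 - r2) * (r3 - r1)"
  using monotone_roots by (auto simp: \<omega>_def mult_nonneg_nonneg mult_nonpos_nonpos)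

lemma k_squared: "k\<^sup>2 = ((r3 - r2) * (r4 - r1)) / ((r3 - r1) * (r4 - r2))"
proof -
  have "0 \<le> (r3 - r2) * (r4 - r1)" "0 \<le> (r3 - r1) * (r4 - r2)"
    using monotone_roots by (auto simp: zero_le_mult_iff)
  then have "0 \<le> ((r3 - r2) * (r4 - r1)) / ((r3 - r1) * (r4 - r2))" by simp
  then show ?thesis by (simp add: k)
qed

lemma k_squared_less_1: "k\<^sup>2 < 1"
proof -
  have "0 < (r3 - r1) * (r4 - r2)" "0 < (r4 - r3) * (r2 - r1)"
    using monotone_roots by (auto simp: zero_less_mult_iff)
  moreover have "(r3 - r1) * (r4 - r2) - (r3 - r2) * (r4 - r1) = (r4 - r3) * (r2 - r1)"
    by (simp add: algebra_simps)
  ultimately show ?thesis by (simp add: k_squared)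
qed

section \<open>The closed form as a solution of the equation of motion\<close>

lemma denominator_pos: "0 < 1 - \<alpha> * (jacobi_sn u k)\<^sup>2"
proof -
  have "\<alpha> * (jacobi_sn u k)\<^sup>2 \<le> \<alpha> * 1"
    using \<alpha>_bounds by (intro mult_left_mono) (auto simp: jacobi_sn_def abs_square_le_1)
  then show ?thesis using \<alpha>_bounds by linarith
qed

lemma Q_0: "Q 0 = r2"
proof -
  have "jacobi_sn 0 k = 0"
    using jacobi_am_elliptic_F[OF k_squared_less_1, of 0] by (simp add: jacobi_sn_def)
  then show ?thesis by (simp add: Q_def)
qed

lemma Q_minus: "Q (- t) = Q t"
  by (simp add: Q_def jacobi_sn_minus k_squared_less_1)

lemma Q'_minus: "Q' (- t) = - Q' t"
  by (simp add: Q'_def jacobi_sn_minus jacobi_cn_minus jacobi_dn_minus k_squared_less_1)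

lemma \<alpha>_eq: "\<alpha> * (r3 - r1) = r3 - r2"
  using monotone_roots by (auto simp: \<alpha>_def)

lemma k_squared_eq: "k\<^sup>2 * (r4 - r2) = \<alpha> * (r4 - r1)"
  using monotone_roots by (auto simp: \<alpha>_def k_squared)

text \<open>Each difference, as a function of S, has its zero where the Moebius map hits that root:
  at 0, 1, 1/k^2 or infinity. The resulting factors S, 1 - S and 1 - k^2 S are the squares of sn, cn
  and dn.\<close>

lemma Q_minus_roots:
  fixes t :: real
  defines "S \<equiv> (jacobi_sn (\<omega> * (t / 2)) k)\<^sup>2"
  shows "Q t - r1 = (r2 - r1) / (1 - \<alpha> * S)"
    and "Q t - r2 = \<alpha> * (r2 - r1) * S / (1 - \<alpha> * S)"
    and "Q t - r3 = - (r3 - r2) * (1 - S) / (1 - \<alpha> * S)"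
    and "Q t - r4 = - (r4 - r2) * (1 - k\<^sup>2 * S) / (1 - \<alpha> * S)"
proof -
  have T: "1 - \<alpha> * S \<noteq> 0"
    using denominator_pos[of "\<omega> * (t / 2)"] by (simp add: S_def)
  have Q: "Q t = (r2 - r1 * \<alpha> * S) / (1 - \<alpha> * S)"
    by (simp add: Q_def S_def)
  have *: "Q t - r = ((r2 - r1 * \<alpha> * S) - r * (1 - \<alpha> * S)) / (1 - \<alpha> * S)" for r
    using T by (simp add: Q field_simps)
  show "Q t - r1 = (r2 - r1) / (1 - \<alpha> * S)"
    unfolding * by (simp add: algebra_simps)
  show "Q t - r2 = \<alpha> * (r2 - r1) * S / (1 - \<alpha> * S)"
    unfolding * by (simp add: algebra_simps)
  have "(r2 - r1 * \<alpha> * S) - r3 * (1 - \<alpha> * S) = - (r3 - r2) * (1 - S)"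
    using \<alpha>_eq by algebra
  then show "Q t - r3 = - (r3 - r2) * (1 - S) / (1 - \<alpha> * S)"
    unfolding * by simp
  have "(r2 - r1 * \<alpha> * S) - r4 * (1 - \<alpha> * S) = - (r4 - r2) * (1 - k\<^sup>2 * S)"
    using k_squared_eq by algebra
  then show "Q t - r4 = - (r4 - r2) * (1 - k\<^sup>2 * S) / (1 - \<alpha> * S)"
    unfolding * by simp
qed

lemma P_Q: "P (Q t) = (Q' t)\<^sup>2"
proof -
  define x where "x = jacobi_sn (\<omega> * (t / 2)) k"
  define c where "c = jacobi_cn (\<omega> * (t / 2)) k"
  define d where "d = jacobi_dn (\<omega> * (t / 2)) k"
  define T where "T = 1 - \<alpha> * x\<^sup>2"
  have T: "T \<noteq> 0"
    using denominator_pos[of "\<omega> * (t / 2)"] by (simp add: T_def x_def)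
  have c: "c\<^sup>2 = 1 - x\<^sup>2" and d: "d\<^sup>2 = 1 - k\<^sup>2 * x\<^sup>2"
    by (simp_all add: c_def d_def x_def jacobi_cn_squared jacobi_dn_squared k_squared_less_1)
  have "P (Q t) = (r2 - r1) / T * (\<alpha> * (r2 - r1) * x\<^sup>2 / T) * (- (r3 - r2) * c\<^sup>2 / T) * (- (r4 - r2) * d\<^sup>2 / T)"
    unfolding P_def Q_minus_roots c d by (simp add: x_def T_def)
  also have "\<dots> = \<alpha> * (r3 - r2) * (r4 - r2) * (r2 - r1)\<^sup>2 * x\<^sup>2 * c\<^sup>2 * d\<^sup>2 / T ^ 4"
    using T by (simp add: field_simps power2_eq_square power4_eq_xxxx)
  also have "\<alpha> * (r3 - r2) * (r4 - r2) = (\<alpha> * \<omega>)\<^sup>2"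
    unfolding power_mult_distrib \<omega>_squared using \<alpha>_eq by algebra
  finally show ?thesis
    unfolding Q'_def x_def[symmetric] c_def[symmetric] d_def[symmetric] T_def[symmetric]
    by (simp add: power_mult_distrib power_divide flip: power_mult)
qed

lemma has_real_derivative_Q: "(Q has_real_derivative Q' t) (at t)"
proof -
  define x where "x = jacobi_sn (\<omega> * (t / 2)) k"
  define c where "c = jacobi_cn (\<omega> * (t / 2)) k"
  define d where "d = jacobi_dn (\<omega> * (t / 2)) k"
  have T: "1 - \<alpha> * x\<^sup>2 \<noteq> 0"
    using denominator_pos[of "\<omega> * (t / 2)"] by (simp add: x_def)
  have dsn: "((\<lambda>t. jacobi_sn (\<omega> * (t / 2)) k) has_real_derivative c * d * (\<omega> / 2)) (at t)"
    unfolding c_def d_def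
    by (rule DERIV_chain2[OF has_real_derivative_jacobi_sn[OF k_squared_less_1]])
      (auto intro!: derivative_eq_intros)
  show ?thesis
    unfolding Q_def[abs_def]
    apply (rule derivative_eq_intros dsn refl)+
    using T
    unfolding Q'_def x_def[symmetric] c_def[symmetric] d_def[symmetric]
     apply (simp_all add: divide_simps)
    apply (simp add: algebra_simps power2_eq_square)
    done
qed

text \<open>The right-hand side is P'(Q)/2 in product-rule form. Differentiating \<open>P_Q\<close>
  would give it only where \<open>Q'\<close> is nonzero, so turning points call for this direct
  computation.\<close>

lemma has_real_derivative_Q':
  "(Q' has_real_derivative ((Q t - r2) * (Q t - r3) * (Q t - r4) + (Q t - r1) * (Q t - r3) * (Q t - r4)
    + (Q t - r1) * (Q t - r2) * (Q t - r4) + (Q t - r1) * (Q t - r2) * (Q t - r3)) / 2) (at t)"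
proof -
  define x where "x = jacobi_sn (\<omega> * (t / 2)) k"
  define c where "c = jacobi_cn (\<omega> * (t / 2)) k"
  define d where "d = jacobi_dn (\<omega> * (t / 2)) k"
  define T where "T = 1 - \<alpha> * x\<^sup>2"
  have T: "T \<noteq> 0"
    using denominator_pos[of "\<omega> * (t / 2)"] by (simp add: T_def x_def)
  have c: "c\<^sup>2 = 1 - x\<^sup>2" and d: "d\<^sup>2 = 1 - k\<^sup>2 * x\<^sup>2"
    by (simp_all add: c_def d_def x_def jacobi_cn_squared jacobi_dn_squared k_squared_less_1)
  have arg: "((\<lambda>t. \<omega> * (t / 2)) has_real_derivative \<omega> / 2) (at t)"
    by (auto intro!: derivative_eq_intros)
  have dsn: "((\<lambda>t. jacobi_sn (\<omega> * (t / 2)) k) has_real_derivative c * d * (\<omega> / 2)) (at t)"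
    unfolding c_def d_def
    by (rule DERIV_chain2[OF has_real_derivative_jacobi_sn[OF k_squared_less_1] arg])
  have dcn: "((\<lambda>t. jacobi_cn (\<omega> * (t / 2)) k) has_real_derivative - x * d * (\<omega> / 2)) (at t)"
    unfolding x_def d_def
    by (rule DERIV_chain2[OF has_real_derivative_jacobi_cn[OF k_squared_less_1] arg])
  have ddn: "((\<lambda>t. jacobi_dn (\<omega> * (t / 2)) k) has_real_derivative - k\<^sup>2 * x * c * (\<omega> / 2)) (at t)"
    unfolding x_def c_def
    by (rule DERIV_chain2[OF has_real_derivative_jacobi_dn[OF k_squared_less_1] arg])
  define N where "N = \<alpha> * (r2 - r1) * \<omega>"
  \<comment> \<open>Up to the factor \<open>N * \<omega> / 2\<close>, \<open>W\<close> is the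
    numerator of the derivative of x c d / T^2 over the common denominator T^3.\<close>
  define W where "W = (c\<^sup>2 * d\<^sup>2 - x\<^sup>2 * d\<^sup>2 - k\<^sup>2 * x\<^sup>2 * c\<^sup>2) * T + 4 * \<alpha> * x\<^sup>2 * c\<^sup>2 * d\<^sup>2"
  have "(Q' has_real_derivative N * \<omega> / 2 * W / T ^ 3) (at t)"
    unfolding Q'_def[abs_def] N_def[symmetric]
    apply (rule derivative_eq_intros dsn dcn ddn refl)+
    using T
    unfolding W_def x_def[symmetric] c_def[symmetric] d_def[symmetric] T_def[symmetric]
     apply (simp_all add: field_simps power2_eq_square power3_eq_cube)
    done
  moreover have "N * \<omega> = (r2 - r1) * (r3 - r2) * (r4 - r2)"
    unfolding N_def using \<alpha>_eq \<omega>_squared by algebra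
  moreover have "(r2 - r1) * (r3 - r2) * (r4 - r2) * W =
      \<alpha> * (r2 - r1) * x\<^sup>2 * (r3 - r2) * c\<^sup>2 * (r4 - r2) * d\<^sup>2
      + (r2 - r1) * (r3 - r2) * c\<^sup>2 * (r4 - r2) * d\<^sup>2
      - (r2 - r1) * (\<alpha> * (r2 - r1) * x\<^sup>2) * (r4 - r2) * d\<^sup>2
      - (r2 - r1) * (\<alpha> * (r2 - r1) * x\<^sup>2) * (r3 - r2) * c\<^sup>2"
    unfolding W_def T_def c d using \<alpha>_eq k_squared_eq by algebra
  moreover have "\<dots> / T ^ 3 = (Q t - r2) * (Q t - r3) * (Q t - r4) + (Q t - r1) * (Q t - r3) * (Q t - r4)
    + (Q t - r1) * (Q t - r2) * (Q t - r4) + (Q t - r1) * (Q t - r2) * (Q t - r3)"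
    unfolding Q_minus_roots x_def[symmetric] T_def[symmetric] c[symmetric] d[symmetric]
    using T by (simp add: field_simps power3_eq_cube)
  moreover have "N * \<omega> / 2 * W / T ^ 3 = N * \<omega> * W / T ^ 3 / 2" by simp
  ultimately show ?thesis by metis
qed

section \<open>Travel times as elliptic integrals\<close>

lemma closed_segment_cases:
  assumes "z \<in> closed_segment r2 r3"
  shows "r1 < r2 \<and> r2 \<le> z \<and> z \<le> r3 \<and> r3 < r4 \<or> r4 < r3 \<and> r3 \<le> z \<and> z \<le> r2 \<and> r2 < r1"
  using assms monotone_roots by (auto simp: closed_segment_eq_real_ivl split: if_splits)

lemma A_bounds:
  assumes "z \<in> closed_segment r2 r3"
  shows "0 \<le> A z" "A z \<le> 1"
proof -
  note cases = closed_segment_cases[OF assms]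
  have pos: "0 < (r3 - r2) * (z - r1)"
    using cases monotone_roots by (auto simp: zero_less_mult_iff)
  have "0 \<le> (r3 - r1) * (z - r2)" "0 \<le> (r2 - r1) * (r3 - z)"
    using cases by (auto simp: zero_le_mult_iff)
  moreover have "(r3 - r2) * (z - r1) - (r3 - r1) * (z - r2) = (r2 - r1) * (r3 - z)"
    by (simp add: algebra_simps)
  ultimately show "0 \<le> A z" "A z \<le> 1"
    using pos by (simp_all add: A_def)
qed

lemma \<tau>_nonneg:
  assumes "z \<in> closed_segment r2 r3"
  shows "0 \<le> \<tau> z"
proof -
  have "0 \<le> arcsin (sqrt (A z))"
    using A_bounds[OF assms] by (intro arcsin_nonneg) auto
  then show ?thesis
    using elliptic_F_le_iff[OF k_squared_less_1, of 0 "arcsin (sqrt (A z))"] \<omega>_pos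
    by (simp add: \<tau>_def)
qed

lemma \<tau>_r2: "\<tau> r2 = 0"
  by (simp add: \<tau>_def A_def)

lemma \<tau>_r3: "\<tau> r3 = 2 * elliptic_F (pi / 2) k / \<omega>"
proof -
  have "A r3 = 1" using monotone_roots by (auto simp: A_def)
  then show ?thesis by (simp add: \<tau>_def)
qed

lemma jacobi_am_\<tau>: "jacobi_am (\<omega> * (\<tau> z / 2)) k = arcsin (sqrt (A z))"
  using \<omega>_pos by (simp add: \<tau>_def jacobi_am_elliptic_F k_squared_less_1)

lemma jacobi_sn_\<tau>:
  assumes "z \<in> closed_segment r2 r3"
  shows "jacobi_sn (\<omega> * (\<tau> z / 2)) k = sqrt (A z)"
  using A_bounds[OF assms] order_trans[of "-1" 0 "sqrt (A z)"]
  unfolding jacobi_sn_def jacobi_am_\<tau> by simp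

lemma Q_\<tau>:
  assumes "z \<in> closed_segment r2 r3"
  shows "Q (\<tau> z) = z"
proof -
  have z: "z \<noteq> r1" using closed_segment_cases[OF assms] by auto
  have r: "r3 \<noteq> r2" "r3 \<noteq> r1" "r1 \<noteq> r2" using monotone_roots by auto
  have "\<alpha> * A z = (z - r2) / (z - r1)"
    using r by (simp add: \<alpha>_def A_def)
  moreover have "Q (\<tau> z) = (r2 - r1 * (\<alpha> * A z)) / (1 - \<alpha> * A z)"
    using A_bounds[OF assms] unfolding Q_def jacobi_sn_\<tau>[OF assms] by simp
  ultimately have Q: "Q (\<tau> z) = (r2 - r1 * ((z - r2) / (z - r1))) / (1 - (z - r2) / (z - r1))"
    by simp
  have "1 - (z - r2) / (z - r1) = (r2 - r1) / (z - r1)"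
    "r2 - r1 * ((z - r2) / (z - r1)) = z * (r2 - r1) / (z - r1)"
    using z by (simp_all add: field_simps)
  then show ?thesis unfolding Q using z r by simp
qed

text \<open>On the first passage the amplitude lies between 0 and pi/2, where sn, cn and dn are
  nonnegative. The sign of \<open>Q'\<close> is therefore that of r2 - r1, which agrees with that of
  r3 - r2 in both orderings.\<close>

lemma Q'_\<tau>:
  assumes "z \<in> closed_segment r2 r3"
  shows "Q' (\<tau> z) = sgn (r3 - r2) * sqrt (P z)"
proof -
  define u where "u = \<omega> * (\<tau> z / 2)"
  have "0 \<le> cos (arcsin (sqrt (A z)))"
    using A_bounds[OF assms] order_trans[of "-1" 0 "sqrt (A z)"] arcsin_bounded[of "sqrt (A z)"]
    by (intro cos_ge_zero) auto
  then have nonneg: "0 \<le> jacobi_sn u k" "0 \<le> jacobi_cn u k" "0 \<le> jacobi_dn u k"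
    using A_bounds[OF assms] jacobi_dn_pos[OF k_squared_less_1, of u]
    unfolding u_def jacobi_sn_\<tau>[OF assms] jacobi_cn_def jacobi_am_\<tau> by simp_all
  define X where "X = \<alpha> * \<omega> * jacobi_sn u k * jacobi_cn u k * jacobi_dn u k / (1 - \<alpha> * (jacobi_sn u k)\<^sup>2)\<^sup>2"
  have "0 \<le> X"
    using nonneg \<alpha>_bounds \<omega>_pos by (simp add: X_def)
  moreover have "Q' (\<tau> z) = (r2 - r1) * X"
    by (simp add: Q'_def u_def X_def)
  moreover have "sqrt (P z) = \<bar>Q' (\<tau> z)\<bar>"
    using P_Q[of "\<tau> z"] by (simp add: Q_\<tau>[OF assms])
  ultimately have "sqrt (P z) = \<bar>r2 - r1\<bar> * X" "Q' (\<tau> z) = (r2 - r1) * X"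
    by (simp_all add: abs_mult)
  moreover have "sgn (r3 - r2) * \<bar>r2 - r1\<bar> = r2 - r1"
    using monotone_roots by auto
  ultimately show ?thesis by (simp flip: mult.assoc)
qed

lemma continuous_on_\<tau>: "continuous_on (closed_segment r2 r3) \<tau>"
proof -
  have "z - r1 \<noteq> 0" if "z \<in> closed_segment r2 r3" for z
    using closed_segment_cases[OF that] by auto
  moreover have "- 1 \<le> sqrt (A z)" "sqrt (A z) \<le> 1" if "z \<in> closed_segment r2 r3" for z
    using A_bounds[OF that] order_trans[of "-1" 0 "sqrt (A z)"] by auto
  ultimately show ?thesis
    unfolding \<tau>_def[abs_def] using \<omega>_pos monotone_roots
    by (intro continuous_intros continuous_on_compose2[OF continuous_on_elliptic_F[OF k_squared_less_1]])
      (auto simp: A_def intro!: continuous_intros)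
qed

lemma P_pos:
  assumes "z \<in> open_segment r2 r3"
  shows "0 < P z"
proof -
  have "r1 < r2 \<and> r2 < z \<and> z < r3 \<and> r3 < r4 \<or> r4 < r3 \<and> r3 < z \<and> z < r2 \<and> r2 < r1"
    using assms monotone_roots by (auto simp: open_segment_eq_real_ivl split: if_splits)
  then have "0 < (z - r1) * (z - r2)" "0 < (z - r3) * (z - r4)"
    by (auto simp: zero_less_mult_iff)
  then have "0 < ((z - r1) * (z - r2)) * ((z - r3) * (z - r4))" by (rule mult_pos_pos)
  then show ?thesis by (simp add: P_def mult.assoc)
qed

text \<open>Here \<open>\<tau>\<close> is differentiated as the inverse of \<open>Q\<close>. This
  works only strictly between the roots, where \<open>P\<close> is positive.\<close>

lemma has_real_derivative_\<tau>:
  assumes "z \<in> open_segment r2 r3"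
  shows "(\<tau> has_real_derivative sgn (r3 - r2) / sqrt (P z)) (at z)"
proof -
  define a where "a = min r2 r3"
  define b where "b = max r2 r3"
  have open_seg: "open_segment r2 r3 = {a<..<b}" and closed_seg: "closed_segment r2 r3 = {a..b}"
    by (auto simp: open_segment_eq_real_ivl closed_segment_eq_real_ivl a_def b_def)
  have z: "a < z" "z < b" using assms by (auto simp: open_seg)
  have "isCont \<tau> z"
    using continuous_on_interior[OF continuous_on_\<tau>, of z] z by (simp add: closed_seg)
  moreover have "sgn (r3 - r2) * sqrt (P z) \<noteq> 0"
    using P_pos[OF assms] monotone_roots by (auto simp: sgn_if)
  moreover have "Q' (\<tau> z) = sgn (r3 - r2) * sqrt (P z)"
    using z by (intro Q'_\<tau>) (simp add: closed_seg)
  ultimately have "(\<tau> has_real_derivative inverse (sgn (r3 - r2) * sqrt (P z))) (at z)"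
    using z has_real_derivative_Q[of "\<tau> z"] Q_\<tau>
    by (intro DERIV_inverse_function[where f = Q and a = a and b = b]) (auto simp: closed_seg)
  moreover have "inverse (sgn (r3 - r2) * sqrt (P z)) = sgn (r3 - r2) / sqrt (P z)"
    by (simp add: sgn_if divide_inverse)
  ultimately show ?thesis by simp
qed

text \<open>Up to the half period \<open>\<tau> r3\<close> the amplitude stays between 0 and pi/2,
  so arcsin undoes the sine.\<close>

lemma \<tau>_Q:
  assumes "0 \<le> t" "t \<le> \<tau> r3"
  shows "\<tau> (Q t) = t"
proof -
  define u where "u = \<omega> * (t / 2)"
  have u: "0 \<le> u" "u \<le> elliptic_F (pi / 2) k"
    using assms \<omega>_pos by (simp_all add: u_def \<tau>_r3 field_simps)
  then have am: "0 \<le> jacobi_am u k" "jacobi_am u k \<le> pi / 2"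
    by (simp_all only: jacobi_am_nonneg_iff jacobi_am_le_iff k_squared_less_1)
  have T: "1 - \<alpha> * (jacobi_sn u k)\<^sup>2 \<noteq> 0"
    using denominator_pos[of u] by simp
  have "A (Q t) = (r3 - r1) * (\<alpha> * (r2 - r1) * (jacobi_sn u k)\<^sup>2) / ((r3 - r2) * (r2 - r1))"
    unfolding A_def Q_minus_roots u_def[symmetric] using T by simp
  also have "\<dots> = (jacobi_sn u k)\<^sup>2"
    using monotone_roots by (auto simp: \<alpha>_def)
  finally have "sqrt (A (Q t)) = sin (jacobi_am u k)"
    using am sin_ge_zero[of "jacobi_am u k"] by (simp add: jacobi_sn_def)
  then have "arcsin (sqrt (A (Q t))) = jacobi_am u k"
    using am by (simp add: arcsin_sin)
  then show ?thesis
    using \<omega>_pos by (simp add: \<tau>_def elliptic_F_jacobi_am k_squared_less_1 u_def)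
qed

text \<open>The differences Q - r2 and r3 - Q are nonnegative multiples of r2 - r1 and r3 - r2, and
  these have equal signs.\<close>

lemma Q_in_segment: "Q t \<in> closed_segment r2 r3"
proof -
  define u where "u = \<omega> * (t / 2)"
  define S where "S = (jacobi_sn u k)\<^sup>2"
  have S: "0 \<le> S" "S \<le> 1" by (simp_all add: S_def jacobi_sn_def abs_square_le_1)
  have T: "0 < 1 - \<alpha> * S" using denominator_pos by (simp add: S_def)
  have "Q t - r2 = (r2 - r1) * (\<alpha> * S / (1 - \<alpha> * S))"
    using Q_minus_roots(2)[of t, folded u_def, folded S_def] by (simp add: mult_ac)
  moreover have "Q t - r3 = - ((r3 - r2) * ((1 - S) / (1 - \<alpha> * S)))"
    using Q_minus_roots(3)[of t, folded u_def, folded S_def] by (simp only: minus_mult_left times_divide_eq_right)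
  then have "r3 - Q t = (r3 - r2) * ((1 - S) / (1 - \<alpha> * S))" by simp
  moreover have "0 \<le> \<alpha> * S / (1 - \<alpha> * S)" "0 \<le> (1 - S) / (1 - \<alpha> * S)"
    using S T \<alpha>_bounds by simp_all
  moreover have "0 \<le> r2 - r1 \<and> 0 \<le> r3 - r2 \<or> r2 - r1 \<le> 0 \<and> r3 - r2 \<le> 0"
    using monotone_roots by auto
  ultimately have "r2 \<le> Q t \<and> Q t \<le> r3 \<or> r3 \<le> Q t \<and> Q t \<le> r2"
    using mult_nonneg_nonneg[of "r2 - r1" "\<alpha> * S / (1 - \<alpha> * S)"] mult_nonneg_nonneg[of "r3 - r2" "(1 - S) / (1 - \<alpha> * S)"]
      mult_nonpos_nonneg[of "r2 - r1" "\<alpha> * S / (1 - \<alpha> * S)"] mult_nonpos_nonneg[of "r3 - r2" "(1 - S) / (1 - \<alpha> * S)"]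
    by linarith
  then show ?thesis
    by (auto simp: closed_segment_eq_real_ivl)
qed

text \<open>The integrand is singular at the roots. The fundamental theorem for nonnegative
  integrands on an open interval applies, with one-sided limits of the antiderivative
  \<open>\<tau>\<close> at the endpoints.\<close>

lemma time_integral_less:
  assumes "r2 < r3" "r2 \<le> z1" "z1 < z2" "z2 \<le> r3"
  shows "(LBINT z=z1..z2. 1 / sqrt (P z)) = \<tau> z2 - \<tau> z1"
proof -
  have open_seg: "z \<in> open_segment r2 r3" if "z1 < z" "z < z2" for z
    using that assms by (simp add: open_segment_eq_real_ivl)
  have cont: "continuous_on {z1..z2} \<tau>"
    using assms by (intro continuous_on_subset[OF continuous_on_\<tau>]) (auto simp: closed_segment_eq_real_ivl)
  show ?thesis
  proof (rule interval_integral_FTC_nonneg(2))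
    show "(\<tau> has_real_derivative 1 / sqrt (P z)) (at z)"
      if "ereal z1 < ereal z" "ereal z < ereal z2" for z
      using has_real_derivative_\<tau>[OF open_seg] that assms(1) by simp
    show "isCont (\<lambda>z. 1 / sqrt (P z)) z" if "ereal z1 < ereal z" "ereal z < ereal z2" for z
      using P_pos[OF open_seg, of z] that unfolding P_def by (intro continuous_intros) auto
    show "AE z in lborel. ereal z1 < ereal z \<longrightarrow> ereal z < ereal z2 \<longrightarrow> 0 \<le> 1 / sqrt (P z)"
      using P_pos[OF open_seg] by (intro AE_I2) (simp add: less_imp_le)
    show "((\<tau> \<circ> real_of_ereal) \<longlongrightarrow> \<tau> z1) (at_right (ereal z1))"
      using continuous_on_Icc_at_rightD[OF cont assms(3)] by (simp add: ereal_tendsto_simps1)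
    show "((\<tau> \<circ> real_of_ereal) \<longlongrightarrow> \<tau> z2) (at_left (ereal z2))"
      using continuous_on_Icc_at_leftD[OF cont assms(3)] by (simp add: ereal_tendsto_simps1)
  qed (use assms in simp)
qed

lemma time_integral:
  assumes "r2 < r3" "z1 \<in> {r2..r3}" "z2 \<in> {r2..r3}"
  shows "(LBINT z=z1..z2. 1 / sqrt (P z)) = \<tau> z2 - \<tau> z1"
proof -
  consider "z1 < z2" | "z1 = z2" | "z2 < z1" by linarith
  then show ?thesis
  proof cases
    case 1
    then show ?thesis using assms by (intro time_integral_less) auto
  next
    case 2
    then show ?thesis by simp
  next
    case 3
    then have "(LBINT z=z2..z1. 1 / sqrt (P z)) = \<tau> z1 - \<tau> z2"
      using assms by (intro time_integral_less) auto
    then show ?thesis by (subst interval_integral_endpoints_reverse) simp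
  qed
qed

end

section \<open>Uniqueness for autonomous second-order equations\<close>

text \<open>After \<open>s\<close> the product of E with exp(-ct) cannot increase, and before
  \<open>s\<close> the product with exp(ct) cannot decrease. Since E vanishes at \<open>s\<close>,
  nonnegativity forces zero on both sides.\<close>

lemma gronwall_zero:
  fixes E :: "real \<Rightarrow> real"
  assumes deriv: "\<And>t. (E has_real_derivative E' t) (at t)"
    and bound: "\<And>t. \<bar>E' t\<bar> \<le> c * E t" and nonneg: "\<And>t. 0 \<le> E t" and zero: "E s = 0"
  shows "E t = 0"
proof (cases "s \<le> t")
  case True
  have "\<exists>d\<le>0. ((\<lambda>t. E t * exp (- c * t)) has_real_derivative d) (at z)" for z
    using deriv[of z] bound[of z]
    by (intro exI[of _ "(E' z - c * E z) * exp (- c * z)"] conjI)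
      (auto intro!: derivative_eq_intros mult_nonpos_nonneg simp: algebra_simps)
  then have "E t * exp (- c * t) \<le> E s * exp (- c * s)"
    using DERIV_nonpos_imp_nonincreasing[OF True, of "\<lambda>t. E t * exp (- c * t)"] by blast
  then show ?thesis using zero nonneg[of t] by (simp add: mult_le_0_iff)
next
  case False
  then have le: "t \<le> s" by simp
  have "\<exists>d\<ge>0. ((\<lambda>t. E t * exp (c * t)) has_real_derivative d) (at z)" for z
  proof (intro exI conjI)
    show "0 \<le> (E' z + c * E z) * exp (c * z)"
      using bound[of z] by (intro mult_nonneg_nonneg) auto
    show "((\<lambda>t. E t * exp (c * t)) has_real_derivative (E' z + c * E z) * exp (c * z)) (at z)"
      using deriv[of z] by (auto intro!: derivative_eq_intros simp: algebra_simps)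
  qed
  then have "E t * exp (c * t) \<le> E s * exp (c * s)"
    using DERIV_nonneg_imp_nondecreasing[OF le, of "\<lambda>t. E t * exp (c * t)"] by blast
  then show ?thesis using zero nonneg[of t] by (simp add: mult_le_0_iff)
qed

text \<open>Gronwall is applied to the squared distance in the phase plane of position and velocity.
  The Lipschitz bound is needed only along the two solutions, so a non-globally Lipschitz cubic
  force is allowed.\<close>

lemma second_order_ode_unique:
  fixes u v u' v' g :: "real \<Rightarrow> real"
  assumes u: "\<And>t. (u has_real_derivative u' t) (at t)" "\<And>t. (u' has_real_derivative g (u t)) (at t)"
    and v: "\<And>t. (v has_real_derivative v' t) (at t)" "\<And>t. (v' has_real_derivative g (v t)) (at t)"
    and lip: "\<And>t. \<bar>g (u t) - g (v t)\<bar> \<le> L * \<bar>u t - v t\<bar>"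
    and init: "u t0 = v t0" "u' t0 = v' t0"
  shows "u t = v t" "u' t = v' t"
proof -
  define E where "E t = (u t - v t)\<^sup>2 + (u' t - v' t)\<^sup>2" for t
  define E' where "E' t = 2 * ((u t - v t) * (u' t - v' t)) + 2 * ((u' t - v' t) * (g (u t) - g (v t)))" for t
  have "(E has_real_derivative E' t) (at t)" for t
    unfolding E_def[abs_def] E'_def
    using u[of t] v[of t] by (auto intro!: derivative_eq_intros simp: algebra_simps)
  moreover have "\<bar>E' t\<bar> \<le> (1 + \<bar>L\<bar>) * E t" for t
  proof -
    define d e h where "d = \<bar>u t - v t\<bar>" "e = \<bar>u' t - v' t\<bar>" "h = \<bar>g (u t) - g (v t)\<bar>"
    have "L * d \<le> \<bar>L\<bar> * d" by (intro mult_right_mono) (auto simp: d_e_h_def)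
    then have "e * h \<le> e * (\<bar>L\<bar> * d)"
      using lip[of t] by (intro mult_left_mono) (auto simp: d_e_h_def)
    moreover have "\<bar>E' t\<bar> \<le> 2 * d * e + 2 * (e * h)"
      using abs_triangle_ineq[of "2 * ((u t - v t) * (u' t - v' t))" "2 * ((u' t - v' t) * (g (u t) - g (v t)))"]
      unfolding E'_def d_e_h_def abs_mult by simp
    ultimately have "\<bar>E' t\<bar> \<le> (1 + \<bar>L\<bar>) * (2 * d * e)" by (simp add: algebra_simps)
    also have "\<dots> \<le> (1 + \<bar>L\<bar>) * (d\<^sup>2 + e\<^sup>2)"
      using sum_squares_bound[of d e] by (intro mult_left_mono) auto
    finally show ?thesis by (simp add: d_e_h_def E_def)
  qed
  ultimately have "E t = 0"
    by (rule gronwall_zero[where s = t0]) (auto simp: E_def init)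
  then show "u t = v t" "u' t = v' t"
    by (simp_all add: E_def sum_power2_eq_zero_iff)
qed

section \<open>Closed invariant curves\<close>

lemma K_sxt_commute: "K_sxt a p q = K_sxt a q p"
  by (simp add: K_sxt_def algebra_simps)

text \<open>Completing the square in \<open>p\<close>: the squared term is dK/dp, which is the
  velocity dq/dt.\<close>

lemma sxt_P_on_level:
  assumes "K_sxt a p q = H"
  shows "sxt_P a H q = (2 * (q + 1) * p + q\<^sup>2 - a * q)\<^sup>2"
  unfolding assms[symmetric] sxt_P_def K_sxt_def by algebra

text \<open>Discriminant and square differ by a multiple of (q + 1)(K - H), so q = -1 has to be
  excluded.\<close>

lemma on_level_if_sxt_P:
  assumes "sxt_P a H q = (2 * (q + 1) * p + q\<^sup>2 - a * q)\<^sup>2" "q \<noteq> - 1"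
  shows "K_sxt a p q = H"
proof -
  have "(q + 1) * (K_sxt a p q - H) = 0"
    using assms(1) unfolding K_sxt_def sxt_P_def by algebra
  then show ?thesis using assms(2) by auto
qed

definition branch :: "real \<Rightarrow> real \<Rightarrow> real \<Rightarrow> real \<Rightarrow> real" where
  "branch a H \<sigma> q = (\<sigma> * sqrt (sxt_P a H q) - q\<^sup>2 + a * q) / (2 * (q + 1))"

lemma K_sxt_branch:
  assumes "\<sigma>\<^sup>2 = 1" "q \<noteq> - 1" "0 \<le> sxt_P a H q"
  shows "K_sxt a (branch a H \<sigma> q) q = H"
proof -
  define p where "p = branch a H \<sigma> q"
  have q1: "q + 1 \<noteq> 0" using assms(2) by linarith
  have p: "2 * (q + 1) * p = \<sigma> * sqrt (sxt_P a H q) - q\<^sup>2 + a * q"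
    using q1 by (simp add: p_def branch_def field_simps)
  have "(\<sigma> * sqrt (sxt_P a H q))\<^sup>2 = sxt_P a H q"
    using assms by (simp add: power_mult_distrib)
  then have "(2 * (q + 1) * p + q\<^sup>2 - a * q)\<^sup>2 = sxt_P a H q" unfolding p by simp
  then show ?thesis using on_level_if_sxt_P assms(2) by (simp add: p_def)
qed

lemma on_level_imp_branch:
  assumes "K_sxt a p q = H" "q \<noteq> - 1"
  obtains \<sigma> where "\<sigma>\<^sup>2 = 1" "p = branch a H \<sigma> q"
proof -
  define w where "w = 2 * (q + 1) * p + q\<^sup>2 - a * q"
  define \<sigma> where "\<sigma> = (if 0 \<le> w then 1 else - 1 :: real)"
  have q1: "q + 1 \<noteq> 0" using assms(2) by linarith
  have "\<sigma> * sqrt (sxt_P a H q) = w"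
    unfolding sxt_P_on_level[OF assms(1)] w_def[symmetric] \<sigma>_def by simp
  then have "branch a H \<sigma> q = (2 * (q + 1) * p) / (2 * (q + 1))"
    by (simp add: branch_def w_def)
  then have "p = branch a H \<sigma> q" using q1 by simp
  then show ?thesis using that[of \<sigma>] by (simp add: \<sigma>_def split: if_splits)
qed

lemma continuous_on_branch:
  assumes "\<And>q. q \<in> S \<Longrightarrow> q \<noteq> - 1"
  shows "continuous_on S (branch a H \<sigma>)"
proof -
  have "2 * (q + 1) \<noteq> 0" if "q \<in> S" for q using assms[OF that] by (auto simp: add_eq_0_iff)
  then show ?thesis
    unfolding branch_def[abs_def] sxt_P_def by (intro continuous_intros ballI)
qed

lemma isCont_sxt_P: "isCont (sxt_P a H) q"
  unfolding sxt_P_def[abs_def] by (intro continuous_intros)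

text \<open>Both sides are monic quartics that vanish at the same four distinct points.\<close>

lemma sxt_P_factorization:
  assumes "q1 < q2" "q2 < q3" "q3 < q4" "{z. sxt_P a H z = 0} = {q1, q2, q3, q4}"
  shows "sxt_P a H z = (z - q1) * (z - q2) * (z - q3) * (z - q4)"
proof -
  define p where "p = [:4 * H, 4 * H, a\<^sup>2 - 4, - 2 * (2 + a), 1:]"
  define r where "r = [:- q1, 1:] * [:- q2, 1:] * [:- q3, 1:] * [:- q4, 1:]"
  have poly_p: "poly p z = sxt_P a H z" for z
    by (simp add: p_def sxt_P_def) algebra
  have poly_r: "poly r z = (z - q1) * (z - q2) * (z - q3) * (z - q4)" for z
    by (simp add: r_def) algebra
  have "p = r"
  proof (rule poly_eqI_degree_lead_coeff)
    show "poly p z = poly r z" if "z \<in> {q1, q2, q3, q4}" for z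
      using that assms(4) by (auto simp: poly_p poly_r)
    show "4 \<le> card {q1, q2, q3, q4}" using assms by auto
    show "poly.coeff p 4 = poly.coeff r 4"
      by (simp add: p_def r_def numeral_eq_Suc)
    show "degree p \<le> 4" "degree r \<le> 4"
      by (simp_all add: p_def r_def)
  qed
  then show ?thesis using poly_p poly_r by metis
qed

text \<open>Shifting the parametrization makes the deleted point the base point; a simple loop
  without its base point is still connected.\<close>

lemma connected_simple_loop_delete:
  assumes "simple_path g" "pathfinish g = pathstart g"
  shows "connected (path_image g - {z})"
proof (cases "z \<in> path_image g")
  case True
  then obtain c where c: "c \<in> {0..1}" "z = g c" by (auto simp: path_image_def)
  have "connected (path_image (shiftpath c g) - {pathstart (shiftpath c g), pathfinish (shiftpath c g)})"
    using c assms by (intro connected_simple_path_endless simple_path_shiftpath) auto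
  then show ?thesis
    using c assms by (simp add: path_image_shiftpath pathstart_shiftpath pathfinish_shiftpath)
next
  case False
  then show ?thesis using assms(1) by (simp add: connected_simple_path_image)
qed

text \<open>A ray from a point of the bounded open inside must cross its frontier, which is
  contained in \<open>C\<close>.\<close>

lemma inside_meets_ray:
  fixes C :: "'a::euclidean_space set"
  assumes "compact C" "0 \<in> inside C" "l \<noteq> 0"
  obtains d where "0 < d" "d *\<^sub>R l \<in> C"
proof -
  have closed: "closed C" and bounded: "bounded (inside C)"
    using assms by (auto simp: compact_imp_closed compact_imp_bounded bounded_inside)
  have "0 \<in> interior (inside C)"
    using open_inside[OF closed] assms(2) by (simp add: interior_open)
  then obtain d where "0 < d" "0 + d *\<^sub>R l \<in> frontier (inside C)"
    using ray_to_frontier[OF bounded _ assms(3), of 0] by blast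
  then show ?thesis
    using that frontier_inside_subset[OF closed] by auto
qed

section \<open>Position, symmetry and projection of an invariant curve\<close>

context
  fixes a H :: real and C :: "(real \<times> real) set"
  assumes curve: "closed_invariant_curve a H C"
begin

lemma curve_component: "C \<in> components {(q, p). K_sxt a p q = H}"
  using curve by (simp add: closed_invariant_curve_def)

lemma curve_on_level: "(q, p) \<in> C \<Longrightarrow> K_sxt a p q = H"
  using in_components_subset[OF curve_component] by auto

lemma connected_curve: "connected C"
  using curve_component by (rule in_components_connected)

lemma compact_curve: "compact C"
  using curve by (auto simp: closed_invariant_curve_def compact_simple_path_image)

lemma connected_curve_delete: "connected (C - {z})"
  using curve connected_simple_loop_delete by (auto simp: closed_invariant_curve_def)

lemma curve_maximal:
  assumes "connected T" "\<And>q p. (q, p) \<in> T \<Longrightarrow> K_sxt a p q = H" "z \<in> T" "z \<in> C"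
  shows "T \<subseteq> C"
  using assms by (intro components_maximal[OF curve_component]) auto

text \<open>A continuation principle: the graph is a connected part of the level set, so the
  component \<open>C\<close> absorbs it as soon as the two meet.\<close>

lemma curve_graph:
  assumes "continuous_on {u..v} h" "\<And>q. q \<in> {u..v} \<Longrightarrow> K_sxt a (h q) q = H"
    and "q0 \<in> {u..v}" "(q0, h q0) \<in> C" "q \<in> {u..v}"
  shows "(q, h q) \<in> C"
proof -
  have "connected ((\<lambda>q. (q, h q)) ` {u..v})"
    using assms(1) by (intro connected_continuous_image continuous_intros) auto
  then have "(\<lambda>q. (q, h q)) ` {u..v} \<subseteq> C"
    using assms by (rule_tac curve_maximal[where z = "(q0, h q0)"]) auto
  then show ?thesis using assms(5) by auto
qed

text \<open>On either axis K reduces to the square of the other coordinate, so the points where the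
  rays from the origin meet \<open>C\<close> are determined by \<open>H\<close>.\<close>

lemma curve_axes: "0 < H" "(0, sqrt H) \<in> C" "(sqrt H, 0) \<in> C" "(- sqrt H, 0) \<in> C"
proof -
  have inside: "0 \<in> inside C"
    using curve by (simp add: closed_invariant_curve_def zero_prod_def)
  obtain d where d: "0 < d" "(0, d) \<in> C"
    using inside_meets_ray[OF compact_curve inside, of "(0, 1)"] by (auto simp: zero_prod_def)
  then have "d\<^sup>2 = H" using curve_on_level[OF d(2)] by (simp add: K_sxt_def)
  then have sqrt: "sqrt H = d" using d(1) by auto
  show "0 < H" using \<open>d\<^sup>2 = H\<close> d(1) by auto
  show "(0, sqrt H) \<in> C" using d sqrt by simp
  obtain e where e: "0 < e" "(e, 0) \<in> C"
    using inside_meets_ray[OF compact_curve inside, of "(1, 0)"] by (auto simp: zero_prod_def)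
  then have "e\<^sup>2 = H" using curve_on_level[OF e(2)] by (simp add: K_sxt_def)
  then show "(sqrt H, 0) \<in> C" using e by auto
  obtain e' where e': "0 < e'" "(- e', 0) \<in> C"
    using inside_meets_ray[OF compact_curve inside, of "(- 1, 0)"] by (auto simp: zero_prod_def)
  then have "e'\<^sup>2 = H" using curve_on_level[OF e'(2)] by (simp add: K_sxt_def)
  then show "(- sqrt H, 0) \<in> C" using e' by auto
qed

text \<open>K is symmetric, so the reflected curve is a connected part of the same level set. It
  shares the point (\<open>sqrt H\<close>, 0) with \<open>C\<close> and is absorbed.\<close>

lemma curve_swap:
  assumes "(q, p) \<in> C"
  shows "(p, q) \<in> C"
proof -
  have "connected (prod.swap ` C)"
    by (intro connected_continuous_image connected_curve continuous_on_swap)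
  moreover have "(sqrt H, 0) \<in> prod.swap ` C"
    using curve_axes(2) by (force simp: image_iff)
  ultimately have "prod.swap ` C \<subseteq> C"
    using curve_axes(3) curve_on_level
    by (rule_tac curve_maximal[where z = "(sqrt H, 0)"]) (auto, metis K_sxt_commute)
  then show ?thesis using assms by force
qed

text \<open>At q = -1 the terms quadratic in \<open>p\<close> cancel and the level equation becomes
  linear. If it also lost its linear term, the compact curve would contain the whole line.\<close>

lemma curve_meets_line_once:
  assumes "(- 1, p) \<in> C"
  shows "a \<noteq> - 1" and "p = (H - 1) / (1 + a)"
proof -
  have eq: "p * (1 + a) + 1 = H"
    using curve_on_level[OF assms] by (simp add: K_sxt_def algebra_simps)
  show a: "a \<noteq> - 1"
  proof
    assume "a = - 1"
    then have "K_sxt a r (- 1) = H" for r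
      using eq by (simp add: K_sxt_def)
    moreover have "connected ((\<lambda>r. (- 1 :: real, r)) ` (UNIV :: real set))"
      by (intro connected_continuous_image continuous_intros) auto
    ultimately have "(\<lambda>r. (- 1, r)) ` UNIV \<subseteq> C"
      using assms by (rule_tac curve_maximal[where z = "(- 1, p)"]) auto
    then have "snd ` (\<lambda>r. (- 1 :: real, r)) ` UNIV \<subseteq> snd ` C" by (rule image_mono)
    moreover have "bounded (snd ` C)"
      by (intro compact_imp_bounded compact_continuous_image compact_curve continuous_intros)
    ultimately have "bounded (UNIV :: real set)"
      by (rule_tac bounded_subset) (auto simp: image_image)
    then show False by simp
  qed
  show "p = (H - 1) / (1 + a)"
    using eq a by (simp add: field_simps)
qed

text \<open>Removing the only possible point on the line leaves \<open>C\<close> connected, so all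
  of \<open>C\<close> lies on the side of the origin. But the level set continues through that point
  as a graph to the other side.\<close>

lemma curve_not_on_line: "(- 1, p) \<notin> C"
proof
  assume p: "(- 1, p) \<in> C"
  define c where "c = 1 + a"
  have c: "c \<noteq> 0" using curve_meets_line_once(1)[OF p] by (simp add: c_def)
  have right: "- 1 \<le> q" if "(q, r) \<in> C" for q r
  proof (rule ccontr)
    assume q: "\<not> - 1 \<le> q"
    define Z where "Z = fst ` (C - {(- 1, p)})"
    have "connected Z"
      unfolding Z_def by (intro connected_continuous_image connected_curve_delete continuous_intros)
    moreover have "q \<in> Z" "0 \<in> Z"
      using that q curve_axes(2) by (force simp: Z_def)+
    ultimately have "- 1 \<in> Z"
      using q connected_contains_Icc[of Z q 0] by auto
    then show False
      using curve_meets_line_once(2)[OF p] curve_meets_line_once(2) by (auto simp: Z_def)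
  qed
  \<comment> \<open>The usual quadratic formula breaks down at q = -1, where the leading coefficient
    vanishes. The rationalized root \<open>h\<close> is regular there, and the sign \<open>e\<close>
    avoids cancellation in its denominator.\<close>
  define e where "e = sgn c"
  define D where "D q = q\<^sup>2 - a * q + e * sqrt (sxt_P a H q)" for q
  define h where "h q = 2 * (H - q\<^sup>2) / D q" for q
  have e: "e\<^sup>2 = 1" using c by (simp add: e_def sgn_if)
  have P1: "sxt_P a H (- 1) = c\<^sup>2" by (simp add: sxt_P_def c_def algebra_simps power2_eq_square)
  have D1: "D (- 1) = 2 * c" by (simp add: D_def P1 e_def sgn_if c_def)
  have contD: "isCont D q" for q
    unfolding D_def[abs_def] using isCont_sxt_P by (intro continuous_intros) 
  have "\<forall>\<^sub>F q in nhds (- 1). 0 < sxt_P a H q"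
    using c by (intro order_tendstoD(1)[OF isCont_sxt_P[unfolded isCont_def tendsto_at_iff_tendsto_nhds]])
      (simp add: P1)
  moreover have "\<forall>\<^sub>F q in nhds (- 1). D q \<noteq> 0"
    using c by (intro tendsto_imp_eventually_ne[OF contD[unfolded isCont_def tendsto_at_iff_tendsto_nhds]])
      (simp add: D1)
  ultimately have "\<forall>\<^sub>F q in nhds (- 1). 0 < sxt_P a H q \<and> D q \<noteq> 0"
    by eventually_elim simp
  then obtain \<delta> where \<delta>: "0 < \<delta>" "\<And>q. \<bar>q + 1\<bar> < \<delta> \<Longrightarrow> 0 < sxt_P a H q \<and> D q \<noteq> 0"
    by (auto simp: eventually_nhds_metric dist_real_def)
  let ?I = "{- 1 - \<delta> / 2..- 1}"
  have I: "0 < sxt_P a H q" "D q \<noteq> 0" if "q \<in> ?I" for q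
    using \<delta>(2)[of q] \<delta>(1) that by auto
  have "continuous_on ?I h"
    unfolding h_def[abs_def] using I contD
    by (intro continuous_intros) (auto intro: continuous_at_imp_continuous_on)
  moreover have "K_sxt a (h q) q = H" if "q \<in> ?I" for q
  proof -
    have "(e * sqrt (sxt_P a H q))\<^sup>2 = sxt_P a H q"
      using I[OF that] e by (simp add: power_mult_distrib)
    then have "(D q - (q\<^sup>2 - a * q))\<^sup>2 = sxt_P a H q" by (simp add: D_def)
    moreover have "h q * D q = 2 * (H - q\<^sup>2)" using I[OF that] by (simp add: h_def)
    ultimately have "(D q)\<^sup>2 * (K_sxt a (h q) q - H) = 0"
      unfolding K_sxt_def sxt_P_def by algebra
    then show ?thesis using I[OF that] by simp
  qed
  moreover have h: "h (- 1) = p"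
    unfolding h_def D1 mult_divide_mult_cancel_left_if using curve_meets_line_once(2)[OF p] by (simp add: c_def)
  ultimately have "(- 1 - \<delta> / 2, h (- 1 - \<delta> / 2)) \<in> C"
    using p \<delta>(1) by (rule_tac curve_graph[where u = "- 1 - \<delta> / 2" and v = "- 1" and ?q0.0 = "- 1" and h = h]) simp_all
  then show False using right[of "- 1 - \<delta> / 2" "h (- 1 - \<delta> / 2)"] \<delta>(1) by simp
qed

lemma curve_right_of_line:
  assumes "(q, p) \<in> C"
  shows "- 1 < q"
proof (rule ccontr)
  assume q: "\<not> - 1 < q"
  have "connected (fst ` C)"
    by (intro connected_continuous_image connected_curve continuous_intros)
  moreover have "q \<in> fst ` C" "0 \<in> fst ` C"
    using assms curve_axes(2) by force+
  ultimately have "- 1 \<in> fst ` C"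
    using q connected_contains_Icc[of "fst ` C" q 0] by auto
  then show False using curve_not_on_line by auto
qed

text \<open>Where the discriminant is positive, the branch through the point is defined on both
  sides, so \<open>q\<close> cannot be extreme on the curve.\<close>

lemma curve_extends:
  assumes "(q, p) \<in> C" "0 < sxt_P a H q"
  obtains \<delta> where "0 < \<delta>" "q - \<delta> \<in> fst ` C" "q + \<delta> \<in> fst ` C"
proof -
  have q: "- 1 < q" using curve_right_of_line[OF assms(1)] .
  obtain \<sigma> where \<sigma>: "\<sigma>\<^sup>2 = 1" "p = branch a H \<sigma> q"
    using on_level_imp_branch[OF curve_on_level[OF assms(1)]] q by (metis less_irrefl)
  have "\<forall>\<^sub>F z in nhds q. 0 < sxt_P a H z"
    using assms(2) by (rule order_tendstoD(1)[OF isCont_sxt_P[unfolded isCont_def tendsto_at_iff_tendsto_nhds]])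
  moreover have "\<forall>\<^sub>F z in nhds q. - 1 < z"
    using q eventually_nhds_in_open[of "{-1<..}" q] by simp
  ultimately have "\<forall>\<^sub>F z in nhds q. 0 < sxt_P a H z \<and> - 1 < z"
    by eventually_elim simp
  then obtain \<delta> where \<delta>: "0 < \<delta>" "\<And>z. \<bar>z - q\<bar> < \<delta> \<Longrightarrow> 0 < sxt_P a H z \<and> - 1 < z"
    by (auto simp: eventually_nhds_metric dist_real_def)
  have I: "0 < sxt_P a H z" "- 1 < z" if "z \<in> {q - \<delta> / 2..q + \<delta> / 2}" for z
    using \<delta>(2)[of z] \<delta>(1) that by (auto simp: abs_less_iff)
  have "(z, branch a H \<sigma> z) \<in> C" if "z \<in> {q - \<delta> / 2..q + \<delta> / 2}" for z
  proof (rule curve_graph[OF _ _ _ _ that])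
    show "continuous_on {q - \<delta> / 2..q + \<delta> / 2} (branch a H \<sigma>)"
      using I by (intro continuous_on_branch) force
    show "K_sxt a (branch a H \<sigma> z) z = H" if "z \<in> {q - \<delta> / 2..q + \<delta> / 2}" for z
      using I[OF that] \<sigma>(1) by (intro K_sxt_branch) auto
    show "(q, branch a H \<sigma> q) \<in> C" using assms(1) \<sigma>(2) by simp
  qed (use \<delta>(1) in auto)
  from this[of "q - \<delta> / 2"] this[of "q + \<delta> / 2"] show ?thesis
    using \<delta>(1) by (intro that[of "\<delta> / 2"]) force+
qed

lemma curve_range:
  assumes roots: "q1 < q2" "q2 < q3" "q3 < q4" "{z. sxt_P a H z = 0} = {q1, q2, q3, q4}"
  shows "fst ` C = {q2..q3}"
proof -
  have compact: "compact (fst ` C)"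
    by (intro compact_continuous_image compact_curve continuous_intros)
  have connected: "connected (fst ` C)"
    by (intro connected_continuous_image connected_curve continuous_intros)
  have ne: "fst ` C \<noteq> {}" using curve_axes(2) by auto
  obtain m where m: "m \<in> fst ` C" "\<And>z. z \<in> fst ` C \<Longrightarrow> m \<le> z"
    using compact_attains_inf[OF compact ne] by auto
  obtain M where M: "M \<in> fst ` C" "\<And>z. z \<in> fst ` C \<Longrightarrow> z \<le> M"
    using compact_attains_sup[OF compact ne] by auto
  have range: "fst ` C = {m..M}"
  proof
    show "fst ` C \<subseteq> {m..M}" using m(2) M(2) by (meson atLeastAtMost_iff subsetI)
    show "{m..M} \<subseteq> fst ` C" by (rule connected_contains_Icc[OF connected m(1) M(1)])
  qed
  have nonneg: "0 \<le> sxt_P a H z" if "z \<in> {m..M}" for z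
    using that sxt_P_on_level[OF curve_on_level] by (auto simp flip: range)
  have "sxt_P a H m = 0"
  proof (rule ccontr)
    assume "sxt_P a H m \<noteq> 0"
    then have pos: "0 < sxt_P a H m" using nonneg[of m] M(2)[OF m(1)] by auto
    obtain p where "(m, p) \<in> C" using m(1) by auto
    then obtain \<delta> where "0 < \<delta>" "m - \<delta> \<in> fst ` C" using curve_extends[OF _ pos] by blast
    then show False using m(2)[of "m - \<delta>"] by simp
  qed
  moreover have "sxt_P a H M = 0"
  proof (rule ccontr)
    assume "sxt_P a H M \<noteq> 0"
    then have pos: "0 < sxt_P a H M" using nonneg[of M] M(2)[OF m(1)] by auto
    obtain p where "(M, p) \<in> C" using M(1) by auto
    then obtain \<delta> where "0 < \<delta>" "M + \<delta> \<in> fst ` C" using curve_extends[OF _ pos] by blast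
    then show False using M(2)[of "M + \<delta>"] by simp
  qed
  ultimately have mM: "m \<in> {q1, q2, q3, q4}" "M \<in> {q1, q2, q3, q4}"
    using roots(4) by auto
  \<comment> \<open>The points of \<open>C\<close> on the q-axis, on either side of the origin, rule
    out a degenerate projection.\<close>
  have "m < M"
    using m(2)[OF imageI[OF curve_axes(4)]] M(2)[OF imageI[OF curve_axes(3)]]
      real_sqrt_gt_zero[OF curve_axes(1)] unfolding fst_conv by linarith
  have neg: "z < m \<or> M < z" if "q1 < z \<and> z < q2 \<or> q3 < z \<and> z < q4" for z
  proof -
    have "((z - q1) * (z - q2)) * ((z - q3) * (z - q4)) < 0"
      using that
    proof
      assume "q1 < z \<and> z < q2"
      then show ?thesis
        using roots(1-3) by (intro mult_neg_pos[OF mult_pos_neg mult_neg_neg]) auto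
    next
      assume "q3 < z \<and> z < q4"
      then show ?thesis
        using roots(1-3) by (intro mult_pos_neg[OF mult_pos_pos mult_pos_neg]) auto
    qed
    then have "sxt_P a H z < 0"
      unfolding sxt_P_factorization[OF roots] by (simp add: mult.assoc)
    then show ?thesis using nonneg[of z] by force
  qed
  \<comment> \<open>One sample point in each gap where the quartic is negative suffices to exclude
    the outer roots as extreme values.\<close>
  have "(q1 + q2) / 2 < m \<or> M < (q1 + q2) / 2" "(q3 + q4) / 2 < m \<or> M < (q3 + q4) / 2"
    by (rule neg; use roots(1-3) in simp)+
  moreover have "m \<le> q3" "q2 \<le> M"
    using mM \<open>m < M\<close> roots(1-3) by auto
  ultimately have "m \<noteq> q1" "M \<noteq> q4"
    using roots(1-3) by auto
  then have "m = q2 \<and> M = q3"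
    using mM \<open>m < M\<close> roots(1-3) by auto
  then show ?thesis using range by simp
qed

text \<open>The two branches meet over \<open>q2\<close>, where the discriminant vanishes. Since
  \<open>C\<close> has a point there, it contains both branches over the whole interval.\<close>

lemma curve_eq:
  assumes roots: "q1 < q2" "q2 < q3" "q3 < q4" "{z. sxt_P a H z = 0} = {q1, q2, q3, q4}"
    and "K_sxt a p q = H" "q \<in> {q2..q3}"
  shows "(q, p) \<in> C"
proof -
  note range = curve_range[OF roots]
  have right: "- 1 < z" "0 \<le> sxt_P a H z" if "z \<in> {q2..q3}" for z
    using that curve_right_of_line sxt_P_on_level[OF curve_on_level] by (auto simp flip: range)
  obtain \<sigma> where \<sigma>: "\<sigma>\<^sup>2 = 1" "p = branch a H \<sigma> q"
    using on_level_imp_branch[OF assms(5)] right(1)[OF assms(6)] by (metis less_irrefl)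
  have P2: "sxt_P a H q2 = 0" using roots(4) by auto
  have "q2 \<in> fst ` C" using roots(2) by (simp add: range)
  then obtain r where r: "(q2, r) \<in> C" by auto
  obtain \<sigma>' where "r = branch a H \<sigma>' q2"
    using on_level_imp_branch[OF curve_on_level[OF r]] curve_right_of_line[OF r] by (metis less_irrefl)
  then have start: "(q2, branch a H \<sigma> q2) \<in> C" using r P2 by (simp add: branch_def)
  have "(q, branch a H \<sigma> q) \<in> C"
  proof (rule curve_graph[where h = "branch a H \<sigma>", OF _ _ _ start assms(6)])
    show "continuous_on {q2..q3} (branch a H \<sigma>)"
      by (rule continuous_on_branch) (metis right(1) less_irrefl)
    show "K_sxt a (branch a H \<sigma> z) z = H" if "z \<in> {q2..q3}" for z
      using right[OF that] \<sigma>(1) by (intro K_sxt_branch) auto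
    show "q2 \<in> {q2..q3}" using roots(2) by simp
  qed
  then show ?thesis using \<sigma>(2) by simp
qed

end

section \<open>The Hamiltonian flow\<close>

text \<open>Half the derivative of \<open>sxt_P\<close>, the force in the second-order equation for
  q.\<close>

definition sxt_force :: "real \<Rightarrow> real \<Rightarrow> real \<Rightarrow> real" where
  "sxt_force a H z = 2 * z ^ 3 - 3 * (2 + a) * z\<^sup>2 + (a\<^sup>2 - 4) * z + 2 * H"

lemma has_real_derivative_sxt_P:
  "(sxt_P a H has_real_derivative 2 * sxt_force a H z) (at z)"
  unfolding sxt_P_def[abs_def] sxt_force_def
  by (auto intro!: derivative_eq_intros simp: algebra_simps)

text \<open>Here \<open>q'\<close> and \<open>p'\<close> are the Hamiltonian vector field dK/dp and
  -dK/dq. The first identity evaluates the quotient rule for the momentum; the second shows that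
  \<open>p\<close> obeys the same second-order equation as \<open>q\<close>.\<close>

lemma sxt_force_identities:
  fixes a p q :: real
  defines "H \<equiv> K_sxt a p q" and "q' \<equiv> 2 * (q + 1) * p + q\<^sup>2 - a * q" and "p' \<equiv> - (p\<^sup>2 + 2 * p * q - a * p + 2 * q)"
  shows "(sxt_force a H q - 2 * q * q' + a * q') * (2 * (q + 1)) - (q' - q\<^sup>2 + a * q) * (2 * q')
      = p' * (2 * (q + 1) * (2 * (q + 1)))"
    and "- (2 * p * p' + (2 * p' * q + q' * (2 * p)) - a * p' + 2 * q') = sxt_force a H p"
  unfolding H_def q'_def p'_def sxt_force_def K_sxt_def by algebra+

lemma sxt_force_lipschitz:
  obtains L where "\<And>u v. u \<in> {l..r} \<Longrightarrow> v \<in> {l..r} \<Longrightarrow> \<bar>sxt_force a H u - sxt_force a H v\<bar> \<le> L * \<bar>u - v\<bar>"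
proof -
  \<comment> \<open>\<open>h\<close> is the difference quotient of the cubic force, a polynomial and
    hence bounded on the compact square.\<close>
  define h where "h w = 2 * ((fst w)\<^sup>2 + fst w * snd w + (snd w)\<^sup>2) - 3 * (2 + a) * (fst w + snd w) + (a\<^sup>2 - 4)"
    for w :: "real \<times> real"
  have "bounded (h ` ({l..r} \<times> {l..r}))"
    unfolding h_def
    by (intro compact_imp_bounded compact_continuous_image continuous_intros compact_Times compact_Icc)
  then obtain L where L: "\<And>w. w \<in> {l..r} \<times> {l..r} \<Longrightarrow> \<bar>h w\<bar> \<le> L"
    by (auto simp: bounded_iff)
  have "\<bar>sxt_force a H u - sxt_force a H v\<bar> \<le> L * \<bar>u - v\<bar>" if "u \<in> {l..r}" "v \<in> {l..r}" for u v
  proof -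
    have "sxt_force a H u - sxt_force a H v = h (u, v) * (u - v)"
      unfolding sxt_force_def h_def fst_conv snd_conv by algebra
    then show ?thesis
      using L[of "(u, v)"] that by (simp add: abs_mult mult_right_mono)
  qed
  then show thesis using that by blast
qed

locale sxt_flow =
  fixes a H :: real and q q' :: "real \<Rightarrow> real"
  assumes deriv_q: "(q has_real_derivative q' t) (at t)"
    and deriv_q': "(q' has_real_derivative sxt_force a H (q t)) (at t)"
    and energy: "(q' t)\<^sup>2 = sxt_P a H (q t)"
    and right: "- 1 < q t"
begin

text \<open>The momentum recovered from the velocity by solving q' = dK/dp, which is possible since
  q > -1.\<close>

definition p :: "real \<Rightarrow> real" where
  "p t = (q' t - (q t)\<^sup>2 + a * q t) / (2 * (q t + 1))"

definition p' :: "real \<Rightarrow> real" where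
  "p' t = - ((p t)\<^sup>2 + 2 * p t * q t - a * p t + 2 * q t)"

lemma p_eq: "q' t = 2 * (q t + 1) * p t + (q t)\<^sup>2 - a * q t"
  using right[of t] by (simp add: p_def field_simps)

lemma on_level: "K_sxt a (p t) (q t) = H"
proof (rule on_level_if_sxt_P)
  show "sxt_P a H (q t) = (2 * (q t + 1) * p t + (q t)\<^sup>2 - a * q t)\<^sup>2"
    by (simp only: energy flip: p_eq)
  show "q t \<noteq> - 1" using right[of t] by simp
qed

lemma deriv_p: "(p has_real_derivative p' t) (at t)"
proof -
  have nz: "2 * (q t + 1) \<noteq> 0" using right[of t] by simp
  have "(p has_real_derivative ((sxt_force a H (q t) - 2 * q t * q' t + a * q' t) * (2 * (q t + 1))
      - (q' t - (q t)\<^sup>2 + a * q t) * (2 * q' t)) / (2 * (q t + 1) * (2 * (q t + 1)))) (at t)"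
    unfolding p_def[abs_def]
    using nz by (auto intro!: derivative_eq_intros deriv_q deriv_q')
  moreover have "(sxt_force a H (q t) - 2 * q t * q' t + a * q' t) * (2 * (q t + 1))
      - (q' t - (q t)\<^sup>2 + a * q t) * (2 * q' t) = p' t * (2 * (q t + 1) * (2 * (q t + 1)))"
    using sxt_force_identities(1)[where a = a and p = "p t" and q = "q t"] by (simp only: on_level p_eq p'_def)
  ultimately show ?thesis using nz by simp
qed

lemma deriv_p': "(p' has_real_derivative sxt_force a H (p t)) (at t)"
proof -
  have "(p' has_real_derivative - (2 * p t * p' t + (2 * p' t * q t + q' t * (2 * p t)) - a * p' t + 2 * q' t)) (at t)"
    unfolding p'_def[abs_def]
    by (auto intro!: derivative_eq_intros deriv_q deriv_p simp: p'_def)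
  moreover have "- (2 * p t * p' t + (2 * p' t * q t + q' t * (2 * p t)) - a * p' t + 2 * q' t) = sxt_force a H (p t)"
    using sxt_force_identities(2)[where a = a and p = "p t" and q = "q t"] by (simp only: on_level p_eq p'_def)
  ultimately show ?thesis by simp
qed

text \<open>Along the flow, the sextupole map \<open>(q, p) \<mapsto> (p, - q + f p)\<close> is a translation in time, because \<open>p\<close> solves
  the same second-order equation as \<open>q\<close>.\<close>

lemma p_eq_shift:
  assumes q: "\<And>t. q t \<in> {l..r}" and p: "\<And>t. p t \<in> {l..r}"
    and T: "q (t0 + T) = p t0" "q' (t0 + T) = p' t0"
  shows "q (t + T) = p t" "q' (t + T) = p' t"
proof -
  obtain L where L: "\<And>u v. u \<in> {l..r} \<Longrightarrow> v \<in> {l..r} \<Longrightarrow> \<bar>sxt_force a H u - sxt_force a H v\<bar> \<le> L * \<bar>u - v\<bar>"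
    using sxt_force_lipschitz[where a = a and H = H and l = l and r = r] by blast
  have shift: "((\<lambda>t. q (t + T)) has_real_derivative q' (t + T)) (at t)"
    "((\<lambda>t. q' (t + T)) has_real_derivative sxt_force a H (q (t + T))) (at t)" for t
    using deriv_q[of "t + T"] deriv_q'[of "t + T"] by (simp_all add: DERIV_shift)
  note unique = second_order_ode_unique[of "\<lambda>t. q (t + T)" "\<lambda>t. q' (t + T)" "sxt_force a H" p p' L t0,
      OF shift deriv_p deriv_p' L[OF q p] T]
  show "q (t + T) = p t" "q' (t + T) = p' t" by (fact unique)+
qed

text \<open>At time \<open>t + T\<close> the momentum formula is fed with \<open>p\<close> and
  \<open>p'\<close> at time \<open>t\<close>. Inserting p' = -dK/dq turns it into the second
  component of the map.\<close>

lemma p_shift: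
  assumes "q (t + T) = p t" "q' (t + T) = p' t"
  shows "p (t + T) = - q t + sxt_f a (p t)"
proof -
  have nz: "p t + 1 \<noteq> 0" using right[of "t + T"] by (simp add: assms(1))
  have "p (t + T) = (p' t - (p t)\<^sup>2 + a * p t) / (2 * (p t + 1))"
    by (simp add: p_def[of "t + T"] assms)
  also have "p' t - (p t)\<^sup>2 + a * p t = 2 * (- q t * (p t + 1) - p t * (p t - a))"
    unfolding p'_def by algebra
  also have "\<dots> / (2 * (p t + 1)) = - q t + sxt_f a (p t)"
    using nz by (simp add: sxt_f_def field_simps)
  finally show ?thesis .
qed

end

section \<open>From the flow to the parametrization of orbits\<close>

lemma branch_sign_sqrt:
  assumes "K_sxt a p q = H" "- 1 < q"
  shows "branch_sign a q p * sqrt (sxt_P a H q) = 2 * (q + 1) * p + q\<^sup>2 - a * q"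
proof -
  define w where "w = 2 * (q + 1) * p + q\<^sup>2 - a * q"
  have "w = 2 * (q + 1) * (p - sxt_f a q / 2)"
    using assms(2) by (simp add: w_def sxt_f_def field_simps power2_eq_square)
  then have "0 \<le> w \<longleftrightarrow> sxt_f a q / 2 \<le> p"
    using assms(2) by (simp add: zero_le_mult_iff)
  then show ?thesis
    unfolding sxt_P_on_level[OF assms(1)] w_def[symmetric] branch_sign_def by auto
qed

text \<open>The phases \<open>t1\<close> and \<open>t2\<close> are times at which q(t) equals
  \<open>q2\<close> and \<open>q3\<close>. The integral formula with the fixed sign \<open>s\<close>
  is valid between these turning points; beyond them the sign of the root changes, which the
  differential equation with varying sign expresses.\<close>

theorem mainTheorem2:
  fixes a H q1 q2 q3 q4 q2' \<kappa> T' s t1 t2 :: real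
    and C :: "(real \<times> real) set"
    and x y :: "nat \<Rightarrow> real"
    and sn1 sn2 q :: "real \<Rightarrow> real"
  assumes a: "- 2 < a" "a < 2"
    and C: "closed_invariant_curve a H C"
    and roots: "q1 < q2" "q2 < q3" "q3 < q4" "{z. sxt_P a H z = 0} = {q1, q2, q3, q4}"
    and \<kappa>: "\<kappa> = sqrt (((q3 - q2) * (q4 - q1)) / ((q3 - q1) * (q4 - q2)))"
    and q2': "q2' = sxt_f a q2 / 2"
    and T': "T' = (LBINT z=q2..q2'. 1 / sqrt (sxt_P a H z))"
    and orbit: "(x 0, y 0) \<in> C" "\<And>n. (x (Suc n), y (Suc n)) = sxt_map a (x n, y n)"
    and s: "s = branch_sign a (x 0) (y 0)"
    and t1: "t1 = - s * (2 * elliptic_F (arcsin (sqrt (((q3 - q1) * (x 0 - q2))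
                / ((q3 - q2) * (x 0 - q1))))) \<kappa> / sqrt ((q4 - q2) * (q3 - q1)))"
    and t2: "t2 = s * (2 * elliptic_F (arcsin (sqrt (((q4 - q2) * (x 0 - q3))
                / ((q3 - q2) * (x 0 - q4))))) \<kappa> / sqrt ((q4 - q2) * (q3 - q1)))"
    and sn1: "\<And>t. sn1 t = jacobi_sn (sqrt ((q4 - q2) * (q3 - q1)) * ((t - t1) / 2)) \<kappa>"
    and sn2: "\<And>t. sn2 t = jacobi_sn (sqrt ((q4 - q2) * (q3 - q1)) * ((t - t2) / 2)) \<kappa>"
    and q: "\<And>t. q t = (q2 - q1 * ((q3 - q2) / (q3 - q1)) * (sn1 t)\<^sup>2)
                    / (1 - (q3 - q2) / (q3 - q1) * (sn1 t)\<^sup>2)"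
  shows "(\<forall>t. q t = (q3 - q4 * ((q3 - q2) / (q4 - q2)) * (sn2 t)\<^sup>2)
                    / (1 - (q3 - q2) / (q4 - q2) * (sn2 t)\<^sup>2))
    \<and> q 0 = x 0
    \<and> (\<forall>t\<in>closed_segment t1 t2. t = s * (LBINT z=x 0..q t. 1 / sqrt (sxt_P a H z)))
    \<and> (\<forall>t. \<exists>\<sigma>\<in>{1, - 1}. (q has_real_derivative \<sigma> * sqrt (sxt_P a H (q t))) (at t))
    \<and> (\<forall>n. x n = q (real n * T'))
    \<and> (\<forall>n\<ge>1. y (n - 1) = q (real n * T'))"
proof -
  interpret E: quartic q1 q2 q3 q4 \<kappa>
    using roots(1-3) \<kappa> by unfold_locales simp_all
  \<comment> \<open>Reversing the roots negates every factor of the modulus in pairs, so both closed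
    forms share \<open>\<kappa>\<close>.\<close>
  interpret R: quartic q4 q3 q2 q1 \<kappa>
  proof
    have "(q2 - q3) * (q1 - q4) / ((q2 - q4) * (q1 - q3)) = (q3 - q2) * (q4 - q1) / ((q3 - q1) * (q4 - q2))"
      by (rule arg_cong2[where f = "(/)"]) (simp_all add: algebra_simps)
    then show "\<kappa> = sqrt ((q2 - q3) * (q1 - q4) / ((q2 - q4) * (q1 - q3)))" using \<kappa> by simp
  qed (use roots(1-3) in simp)
  have P: "sxt_P a H = E.P" "sxt_P a H = R.P"
    using sxt_P_factorization[OF roots] by (auto simp: E.P_def R.P_def fun_eq_iff)
  \<comment> \<open>The derivative is computed once from the factored and once from the expanded
    quartic.\<close>
  have force: "((z - q2) * (z - q3) * (z - q4) + (z - q1) * (z - q3) * (z - q4)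
      + (z - q1) * (z - q2) * (z - q4) + (z - q1) * (z - q2) * (z - q3)) / 2 = sxt_force a H z" for z
  proof -
    have "(sxt_P a H has_real_derivative (z - q2) * (z - q3) * (z - q4) + (z - q1) * (z - q3) * (z - q4)
      + (z - q1) * (z - q2) * (z - q4) + (z - q1) * (z - q2) * (z - q3)) (at z)"
      unfolding P(1) E.P_def[abs_def] by (auto intro!: derivative_eq_intros simp: algebra_simps)
    from DERIV_unique[OF this has_real_derivative_sxt_P] show ?thesis by simp
  qed
  have range: "fst ` C = {q2..q3}" by (rule curve_range[OF C roots])
  have right: "- 1 < z" if "z \<in> {q2..q3}" for z
    using that curve_right_of_line[OF C] by (auto simp flip: range)
  \<comment> \<open>The curve is symmetric under exchange of coordinates, so momenta obey the same
    bounds as positions.\<close>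
  have level_range: "p \<in> {q2..q3}" if "K_sxt a p z = H" "z \<in> {q2..q3}" for p z
    using curve_swap[OF C curve_eq[OF C roots that]] by (force simp flip: range)
  have Q_range: "E.Q t \<in> {q2..q3}" "R.Q t \<in> {q2..q3}" for t
    using E.Q_in_segment[of t] R.Q_in_segment[of t] roots by (simp_all add: closed_segment_eq_real_ivl)
  have deriv_Q': "(E.Q' has_real_derivative sxt_force a H (E.Q t)) (at t)"
    "(R.Q' has_real_derivative sxt_force a H (R.Q t)) (at t)" for t
    using E.has_real_derivative_Q'[of t] R.has_real_derivative_Q'[of t]
    by (simp_all add: force[symmetric] algebra_simps)
  interpret flow: sxt_flow a H E.Q E.Q'
    using E.has_real_derivative_Q deriv_Q'(1) E.P_Q right[OF Q_range(1)]
    by unfold_locales (simp_all add: P(1))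

  have x0: "x 0 \<in> {q2..q3}" and level0: "K_sxt a (y 0) (x 0) = H"
    using orbit(1) curve_on_level[OF C] by (force simp flip: range)+
  have segments: "closed_segment q2 q3 = {q2..q3}" "closed_segment q3 q2 = {q2..q3}"
    "open_segment q2 q3 = {q2<..<q3}" "open_segment q3 q2 = {q2<..<q3}"
    using roots by (auto simp: closed_segment_eq_real_ivl open_segment_eq_real_ivl)
  have s_cases: "s = 1 \<or> s = - 1" by (simp add: s branch_sign_def)
  have \<omega>: "E.\<omega> = sqrt ((q4 - q2) * (q3 - q1))" "R.\<omega> = sqrt ((q4 - q2) * (q3 - q1))"
    by (simp_all add: E.\<omega>_def R.\<omega>_def algebra_simps)
  have t1_eq: "t1 = - s * E.\<tau> (x 0)"
    by (simp add: t1 E.\<tau>_def E.A_def \<omega>)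
  have "R.A (x 0) = ((q4 - q2) * (x 0 - q3)) / ((q3 - q2) * (x 0 - q4))"
    unfolding R.A_def by (subst minus_divide_divide[symmetric]) (simp add: algebra_simps)
  then have t2_eq: "t2 = s * R.\<tau> (x 0)"
    by (simp add: t2 R.\<tau>_def \<omega>)
  have q_eq: "q t = E.Q (t - t1)" for t
    by (simp add: q sn1 E.Q_def E.\<alpha>_def \<omega>)
  \<comment> \<open>The solution is even and its velocity odd in time, so the sign \<open>s\<close>
    in the phase selects the initial direction of motion.\<close>
  have Q0: "E.Q (- t1) = x 0" "E.Q' (- t1) = s * sqrt (sxt_P a H (x 0))"
    using s_cases E.Q_\<tau>[of "x 0"] E.Q'_\<tau>[of "x 0"] E.Q_minus E.Q'_minus x0 roots
    by (auto simp: t1_eq segments P(1))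
  have R0: "R.Q (- t2) = x 0" "R.Q' (- t2) = s * sqrt (sxt_P a H (x 0))"
    using s_cases R.Q_\<tau>[of "x 0"] R.Q'_\<tau>[of "x 0"] R.Q_minus R.Q'_minus x0 roots
    by (auto simp: t2_eq segments P(2))

  have q_eq': "q t = R.Q (t - t2)" for t
  proof -
    obtain L where L: "\<And>u v. u \<in> {q2..q3} \<Longrightarrow> v \<in> {q2..q3} \<Longrightarrow> \<bar>sxt_force a H u - sxt_force a H v\<bar> \<le> L * \<bar>u - v\<bar>"
      using sxt_force_lipschitz[where a = a and H = H and l = q2 and r = q3] by blast
    have shiftE: "((\<lambda>t. E.Q (t - t1)) has_real_derivative E.Q' (t - t1)) (at t)"
      "((\<lambda>t. E.Q' (t - t1)) has_real_derivative sxt_force a H (E.Q (t - t1))) (at t)" for t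
      using E.has_real_derivative_Q[of "t - t1"] deriv_Q'(1)[of "t - t1"]
        DERIV_shift[of _ _ t "- t1"] by simp_all
    have shiftR: "((\<lambda>t. R.Q (t - t2)) has_real_derivative R.Q' (t - t2)) (at t)"
      "((\<lambda>t. R.Q' (t - t2)) has_real_derivative sxt_force a H (R.Q (t - t2))) (at t)" for t
      using R.has_real_derivative_Q[of "t - t2"] deriv_Q'(2)[of "t - t2"]
        DERIV_shift[of _ _ t "- t2"] by simp_all
    have init: "E.Q (0 - t1) = R.Q (0 - t2)" "E.Q' (0 - t1) = R.Q' (0 - t2)"
      using Q0 R0 by simp_all
    show ?thesis
      unfolding q_eq
      by (rule second_order_ode_unique(1)[OF shiftE shiftR L[OF Q_range] init])
  qed

  \<comment> \<open>The times from \<open>q2\<close> to z and from \<open>q3\<close> to z have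
    opposite derivatives, so their sum is constant; at \<open>q3\<close> the second one
    vanishes.\<close>
  have half_period: "E.\<tau> z + R.\<tau> z = E.\<tau> q3" if z: "z \<in> {q2..q3}" for z
  proof -
    have "E.\<tau> z + R.\<tau> z = E.\<tau> q3 + R.\<tau> q3"
    proof (cases "z = q3")
      case False
      then have "z < q3" using z by simp
      have sum_P: "1 / sqrt (E.P w) + - 1 / sqrt (R.P w) = 0" for w
        using P by simp
      have cont: "continuous_on {z..q3} E.\<tau>" "continuous_on {z..q3} R.\<tau>"
        using z by (intro continuous_on_subset[OF E.continuous_on_\<tau>]
            continuous_on_subset[OF R.continuous_on_\<tau>]; simp add: segments)+
      have deriv: "((\<lambda>z. E.\<tau> z + R.\<tau> z) has_real_derivative 0) (at w)" if "z < w" "w < q3" for w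
      proof -
        have w: "w \<in> open_segment q2 q3" "w \<in> open_segment q3 q2"
          using that z by (simp_all add: segments)
        have "sgn (q3 - q2) = 1" "sgn (q2 - q3) = - 1" using roots(2) by simp_all
        then show ?thesis
          using DERIV_add[OF E.has_real_derivative_\<tau>[OF w(1)] R.has_real_derivative_\<tau>[OF w(2)]]
          by (simp only: sum_P)
      qed
      have "E.\<tau> q3 + R.\<tau> q3 = E.\<tau> z + R.\<tau> z"
        using DERIV_isconst2[OF \<open>z < q3\<close> continuous_on_add[OF cont] deriv, of q3] \<open>z < q3\<close> by simp
      then show ?thesis by simp
    qed simp
    then show ?thesis by (simp add: R.\<tau>_r2)
  qed

  have integral: "(LBINT z=z1..z2. 1 / sqrt (sxt_P a H z)) = E.\<tau> z2 - E.\<tau> z1"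
    if "z1 \<in> {q2..q3}" "z2 \<in> {q2..q3}" for z1 z2
    unfolding P(1) using that roots by (intro E.time_integral) auto

  have time: "t = s * (LBINT z=x 0..q t. 1 / sqrt (sxt_P a H z))" if t: "t \<in> closed_segment t1 t2" for t
  proof -
    have "0 \<le> E.\<tau> (x 0)" "0 \<le> R.\<tau> (x 0)"
      using E.\<tau>_nonneg[of "x 0"] R.\<tau>_nonneg[of "x 0"] x0 by (simp_all only: segments)
    then have "0 \<le> s * (t - t1)" "s * (t - t1) \<le> s * (t2 - t1)"
      using t s_cases by (auto simp: t1_eq t2_eq closed_segment_eq_real_ivl split: if_splits)
    moreover have "s * (t2 - t1) = E.\<tau> q3"
      using s_cases half_period[OF x0] by (auto simp: t1_eq t2_eq)
    \<comment> \<open>Between the phases, \<open>s * (t - t1)\<close> runs through one half period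
      starting at 0, exactly where \<open>E.\<tau>\<close> inverts \<open>E.Q\<close>.\<close>
    ultimately have "E.\<tau> (E.Q (s * (t - t1))) = s * (t - t1)"
      by (intro E.\<tau>_Q) auto
    moreover have "E.Q (s * (t - t1)) = q t"
      using s_cases E.Q_minus[of "t - t1"] by (auto simp: q_eq)
    ultimately have "s * (LBINT z=x 0..q t. 1 / sqrt (sxt_P a H z)) = s * (s * (t - t1) - E.\<tau> (x 0))"
      using integral[OF x0, of "q t"] Q_range by (simp add: q_eq)
    then show ?thesis using s_cases by (auto simp: t1_eq)
  qed
  have ode: "\<exists>\<sigma>\<in>{1, - 1}. (q has_real_derivative \<sigma> * sqrt (sxt_P a H (q t))) (at t)" for t
  proof -
    have "q = (\<lambda>t. E.Q (t - t1))" using q_eq by auto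
    then have "(q has_real_derivative E.Q' (t - t1)) (at t)"
      using E.has_real_derivative_Q[of "t - t1"] DERIV_shift[of E.Q _ t "- t1"] by simp
    moreover have "sqrt (sxt_P a H (q t)) = \<bar>E.Q' (t - t1)\<bar>"
      using E.P_Q[of "t - t1"] by (simp add: q_eq P(1))
    ultimately show ?thesis by (cases "0 \<le> E.Q' (t - t1)") auto
  qed

  have p_range: "flow.p t \<in> {q2..q3}" for t
    using level_range[OF flow.on_level Q_range(1)] .
  \<comment> \<open>At the turning point \<open>q2\<close> the velocity is zero, so the two values
    of the momentum coincide in f(q2)/2.\<close>
  have p_0: "flow.p 0 = q2'"
  proof -
    have "E.Q' 0 = 0" using E.Q'_minus[of 0] by simp
    then show ?thesis
      by (simp add: flow.p_def E.Q_0 q2' sxt_f_def algebra_simps power2_eq_square)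
  qed
  have q2'_range: "q2' \<in> {q2..q3}" using p_range[of 0] by (simp add: p_0)
  have T'_eq: "T' = E.\<tau> q2'"
    unfolding T' using integral[of q2 q2'] q2'_range roots by (simp add: E.\<tau>_r2)
  \<comment> \<open>The level equation fixes this velocity only up to sign. The map sends (q2, q2')
    to (q2', r), still on the curve, so r cannot lie below the minimum \<open>q2\<close>; this makes
    \<open>flow.p' 0\<close> nonnegative.\<close>
  have "E.Q' (0 + T') = flow.p' 0"
  proof -
    define r where "r = - q2 + sxt_f a q2'"
    have level: "K_sxt a q2 q2' = H"
      using flow.on_level[of 0] by (simp add: p_0 E.Q_0 K_sxt_commute)
    have q2'_right: "- 1 < q2'" using right[OF q2'_range] .
    have r_eq: "(q2' + 1) * r = - q2 * (q2' + 1) - q2' * (q2' - a)"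
      using q2'_right by (simp add: r_def sxt_f_def field_simps)
    have p'_0: "flow.p' 0 = (q2' + 1) * (r - q2)"
      unfolding flow.p'_def p_0 E.Q_0 right_diff_distrib r_eq by algebra
    have "sxt_P a H q2' = (2 * (q2' + 1) * r + q2'\<^sup>2 - a * q2')\<^sup>2"
      unfolding sxt_P_on_level[OF level] using r_eq by algebra
    then have "K_sxt a r q2' = H"
      using q2'_right by (intro on_level_if_sxt_P) auto
    then have "q2 \<le> r" using level_range[OF _ q2'_range] by auto
    then have "0 \<le> flow.p' 0" using q2'_right by (simp add: p'_0)
    moreover have "sxt_P a H q2' = (flow.p' 0)\<^sup>2"
      unfolding sxt_P_on_level[OF level] p'_0 right_diff_distrib r_eq by algebra
    ultimately show ?thesis
      using E.Q'_\<tau>[of q2'] q2'_range roots by (simp add: T'_eq segments flip: P(1))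
  qed
  then have shift: "E.Q (t + T') = flow.p t" "E.Q' (t + T') = flow.p' t" for t
    using flow.p_eq_shift[OF Q_range(1) p_range, of 0 T'] E.Q_\<tau>[of q2'] q2'_range
    by (simp_all add: T'_eq segments p_0)
  \<comment> \<open>The signed root is dK/dp at the initial point, so the flow starts with the given
    momentum and not with that of the other branch.\<close>
  have y0: "y 0 = flow.p (- t1)"
    using branch_sign_sqrt[OF level0 right[OF x0]] right[OF x0]
    by (simp add: flow.p_def Q0 flip: s)
  \<comment> \<open>The momentum is carried along in the induction because the map needs both
    coordinates.\<close>
  have orbit_eq: "x n = q (real n * T') \<and> y n = flow.p (real n * T' - t1)" for n
  proof (induction n)
    case 0
    then show ?case using Q0(1) y0 by (simp add: q_eq)
  next
    case (Suc n)
    have time: "real (Suc n) * T' - t1 = (real n * T' - t1) + T'" by (simp add: algebra_simps)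
    show ?case
      using orbit(2)[of n] Suc shift flow.p_shift[OF shift]
      unfolding q_eq time by (simp add: sxt_map_def)
  qed
  have "y (n - 1) = q (real n * T')" if "1 \<le> n" for n
    using that orbit_eq orbit(2)[of "n - 1"] by (auto simp: sxt_map_def)
  moreover have "q t = (q3 - q4 * ((q3 - q2) / (q4 - q2)) * (sn2 t)\<^sup>2) / (1 - (q3 - q2) / (q4 - q2) * (sn2 t)\<^sup>2)" for t
  proof -
    have "R.\<alpha> = (q3 - q2) / (q4 - q2)"
      unfolding R.\<alpha>_def by (subst minus_divide_divide[symmetric]) simp
    then show ?thesis by (simp add: q_eq' R.Q_def sn2 \<omega>)
  qed
  moreover have "q 0 = x 0" using Q0(1) by (simp add: q_eq)
  ultimately show ?thesis using time ode orbit_eq by blast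
qed

end
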